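(* Let $\mathcal C=\mathcal A\circ\mathcal B$ be an admissible composition scheme, let $\rho$ be the radius of convergence of $C(z)$, and let $\mu=\rho B'(\rho)/B(\rho)$ be the expected size of an object of $\mathcal B$ under the Boltzmann distribution at $\rho$. Let $q_n$ be the probability of success of each trial of the leap generator for $\mathcal C$ at size $n$. Then $$q_n=[z^n]\frac{1}{1-B(\rho z)/B(\rho)}=\frac1\mu+O(r^n)\quad\text{for some } r\in(0,1).$$ Moreover, if the exact-size uniform random generator $\Gamma A[k]$ used for $\mathcal A_k$ has time complexity $O(k)$ and the Boltzmann sampler $\Gamma B(x)$ used for $\mathcal B$ has linear time complexity, then the expected time complexity of the leap generator for $\mathcal C$ at size $n$ is $O(n)$.
   Context: $\mathbb N=\{0,1,2,\dots\}$ and $\mathbb N^*=\mathbb N\setminus\{0\}$. A combinatorial class $\mathcal C$ is a set with a size function $\gamma\mapsto|\gamma|\in\mathbb N$ such that every $\mathcal C_n=\{\gamma\in\mathcal C:|\gamma|=n\}$ is finite; an object of size $n$ is made of $n$ atoms. Classes are either all unlabeled (set $\delta_n=1$) or all labeled (the atoms of an object of size $n$ carry distinct labels in $\{1,\dots,n\}$, and $\mathcal C_n$ is closed under relabeling; set $\delta_n=1/n!$). The generating function is $C(z)=\sum_n\delta_n|\mathcal C_n|z^n$, and similarly $A(y),B(z)$ for $\mathcal A,\mathcal B$. Composition: if $\mathcal B$ has no object of size $0$, $\mathcal C=\mathcal A\circ\mathcal B$ is the class of objects $\gamma$ obtained from some $\alpha\in\mathcal A$, of size $k$ say, by substituting its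 atoms by objects $\beta_1,\dots,\beta_k\in\mathcal B$; the size is $|\beta_1|+\cdots+|\beta_k|$ and $k$ is the core-size of $\gamma$. In the labeled case this is the usual labeled substitution (a partition of the label set into $k$ blocks, a $\mathcal B$-structure on each block and an $\mathcal A$-structure on the set of blocks). In the unlabeled case the atoms of each object of $\mathcal A$ are assumed to be unambiguously ranked, so $\gamma$ is a pair $(\alpha,(\beta_1,\dots,\beta_{|\alpha|}))$. In both cases $C(z)=A(B(z))$. Let $\rho_A,\rho_B,\rho_C>0$ be the radii of convergence of $A,B,C$ ($\rho_A,\rho_C$ finite). The scheme is supercritical if $\rho_B>\rho_C$ (in which case $B(\rho_C)=\rho_A$). The support of a series is the set of indices of its nonzero coefficients; a series is periodic if its support is contained in $c+d\,\mathbb N$ for some $d\ge2$, $c\ge0$, and aperiodic otherwise. The scheme is admissible if it is supercritical, $A(y),B(z),C(z)$ are aperiodic, and the support of $A(y)$ contains $\mathbb N^*$. A Boltzmann sampler $\Gamma B(x)$ is a procedure drawing $\beta\in\mathcal B$ with probability $\delta_{|\beta|}x^{|\beta|}/B(x)$; it has linear time complexity if the running time of every generation is linearly bounded by the size of the output object. An exact-size uniform generator $\Gamma A[k]$ draws a uniform object of $\mathcal A_k$. Leap generator for $\mathcal C$ at size $n$ (for $n$ such that $\mathcal C_n\neq\emptyset$): at each trial, generate independent objects $\beta_1,\beta_2,\dots$ by calls to $\Gamma B(\rho)$, $\rho=\rho_C$, and stop at the largest $k$ such that $S:=|\beta_1|+\cdots+|\beta_k|\le n$. If $S<n$, the trial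 fails and one restarts with a new independent trial. If $S=n$ (success), call $\alpha\leftarrow\Gamma A[k]$, substitute the $i$th atom of $\alpha$ by $\beta_i$ for each $i\in\{1,\dots,k\}$ (in the labeled setting, moreover assign to the atoms uniformly randomly permuted labels in $\{1,\dots,n\}$), and return the resulting object of $\mathcal C_n$. The assembly and relabeling operations have cost linear in $n$. *)

theory Defs
  imports
    "HOL-Probability.Probability"
    "HOL-Library.Landau_Symbols"
    "HOL-Combinatorics.Permutations"
    "HOL-Analysis.FPS_Convergence"
begin

section \<open>Combinatorial classes\<close>

datatype setting = Unlabeled | Labeled

text \<open>
  The atoms of a labeled object of size \<open>n\<close> are identified with their labels, which are exactly
  \<open>1, \<dots>, n\<close>. Accordingly, \<open>relabel C \<pi> \<gamma>\<close> is the object in which the atom that carried the label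
  \<open>i\<close> in \<open>\<gamma>\<close> carries the label \<open>\<pi> i\<close>. This field is ignored for unlabeled classes.
\<close>

record 'a comb_struct =
  objs :: "'a set"
  csize :: "'a \<Rightarrow> nat"
  relabel :: "(nat \<Rightarrow> nat) \<Rightarrow> 'a \<Rightarrow> 'a"

definition slice :: "'a comb_struct \<Rightarrow> nat \<Rightarrow> 'a set" where
  "slice C n = {\<gamma> \<in> objs C. csize C \<gamma> = n}"

definition closed_under_relabeling :: "'a comb_struct \<Rightarrow> bool" where
  "closed_under_relabeling C \<longleftrightarrow>
     (\<forall>n. \<forall>\<gamma> \<in> slice C n.
        relabel C id \<gamma> = \<gamma> \<and>
        (\<forall>\<pi>. \<pi> permutes {1..n} \<longrightarrow>
           relabel C \<pi> \<gamma> \<in> slice C n \<and>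
           (\<forall>\<sigma>. \<sigma> permutes {1..n} \<longrightarrow>
              relabel C (\<sigma> \<circ> \<pi>) \<gamma> = relabel C \<sigma> (relabel C \<pi> \<gamma>))))"

definition comb_class :: "setting \<Rightarrow> 'a comb_struct \<Rightarrow> bool" where
  "comb_class s C \<longleftrightarrow>
     (\<forall>n. finite (slice C n)) \<and> (s = Labeled \<longrightarrow> closed_under_relabeling C)"

fun delta :: "setting \<Rightarrow> nat \<Rightarrow> real" where
  "delta Unlabeled n = 1"
| "delta Labeled n = 1 / fact n"

definition gf :: "setting \<Rightarrow> 'a comb_struct \<Rightarrow> real fps" where
  "gf s C = Abs_fps (\<lambda>n. delta s n * real (card (slice C n)))"


section \<open>Composition\<close>

text \<open>
  A labeled composite \<open>LComp \<alpha> [(L\<^sub>1, \<beta>\<^sub>1), \<dots>, (L\<^sub>k, \<beta>\<^sub>k)]\<close> consists of a partition of \<open>{1..n}\<close> into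
  the blocks \<open>L\<^sub>i\<close>, listed by increasing minima, a structure on each block and a structure on the
  set of blocks. The structure on \<open>L\<^sub>i\<close> is obtained from the well-labeled object \<open>\<beta>\<^sub>i\<close> by letting
  the label \<open>j\<close> stand for the \<open>j\<close>-th smallest element of \<open>L\<^sub>i\<close>; the structure on the set of
  blocks is obtained from \<open>\<alpha>\<close> by letting the label \<open>i\<close> stand for the block \<open>L\<^sub>i\<close>.
\<close>

datatype ('a, 'b) composite =
    UComp 'a "'b list"
  | LComp 'a "(nat set \<times> 'b) list"

text \<open>
  For a list \<open>w\<close> of \<open>m\<close> distinct numbers, \<open>standardize w\<close> is the permutation of \<open>{1..m}\<close> that maps
  \<open>i\<close> to the rank of the \<open>i\<close>-th entry of \<open>w\<close> among all the entries.
\<close>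

definition standardize :: "nat list \<Rightarrow> nat \<Rightarrow> nat" where
  "standardize w i =
     (if i \<in> {1..length w} then card {y \<in> set w. y \<le> w ! (i - 1)} else i)"

text \<open>
  Relabeling a composite maps each block \<open>L\<close> to \<open>\<pi> ` L\<close>. Since ranks inside a block and the order of
  the blocks may change, the components have to be relabeled and the blocks sorted again.
\<close>

fun relabel_composite ::
  "'a comb_struct \<Rightarrow> 'b comb_struct \<Rightarrow> (nat \<Rightarrow> nat) \<Rightarrow> ('a, 'b) composite \<Rightarrow> ('a, 'b) composite"
where
  "relabel_composite A B \<pi> (UComp \<alpha> \<beta>s) = UComp \<alpha> \<beta>s"
| "relabel_composite A B \<pi> (LComp \<alpha> bs) =
     LComp
       (relabel A (standardize (map (\<lambda>(L, \<beta>). Min (\<pi> ` L)) bs)) \<alpha>)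
       (sort_key (\<lambda>(L, \<beta>). Min L)
          (map (\<lambda>(L, \<beta>).
             (\<pi> ` L, relabel B (standardize (map \<pi> (sorted_list_of_set L))) \<beta>)) bs))"

fun composite_size :: "'b comb_struct \<Rightarrow> ('a, 'b) composite \<Rightarrow> nat" where
  "composite_size B (UComp \<alpha> \<beta>s) = (\<Sum>\<beta>\<leftarrow>\<beta>s. csize B \<beta>)"
| "composite_size B (LComp \<alpha> bs) = (\<Sum>(L, \<beta>)\<leftarrow>bs. csize B \<beta>)"

fun composite_objs ::
  "setting \<Rightarrow> 'a comb_struct \<Rightarrow> 'b comb_struct \<Rightarrow> ('a, 'b) composite set"
where
  "composite_objs Unlabeled A B =
     {UComp \<alpha> \<beta>s | \<alpha> \<beta>s. \<alpha> \<in> objs A \<and> length \<beta>s = csize A \<alpha> \<and> set \<beta>s \<subseteq> objs B}"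
| "composite_objs Labeled A B =
     {LComp \<alpha> bs | \<alpha> bs.
        \<alpha> \<in> objs A \<and> length bs = csize A \<alpha> \<and>
        (\<forall>(L, \<beta>) \<in> set bs. \<beta> \<in> objs B \<and> card L = csize B \<beta>) \<and>
        sorted_wrt (\<lambda>(L, \<beta>) (L', \<beta>'). L \<inter> L' = {} \<and> Min L < Min L') bs \<and>
        (\<Union>(L, \<beta>) \<in> set bs. L) = {1..(\<Sum>(L, \<beta>)\<leftarrow>bs. csize B \<beta>)}}"

definition composition ::
  "setting \<Rightarrow> 'a comb_struct \<Rightarrow> 'b comb_struct \<Rightarrow> ('a, 'b) composite comb_struct"
where
  "composition s A B =
     \<lparr>objs = composite_objs s A B, csize = composite_size B, relabel = relabel_composite A B\<rparr>"


section \<open>Admissible composition schemes\<close>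

definition support :: "real fps \<Rightarrow> nat set" where
  "support f = {n. fps_nth f n \<noteq> 0}"

definition periodic_series :: "real fps \<Rightarrow> bool" where
  "periodic_series f \<longleftrightarrow> (\<exists>c d. d \<ge> 2 \<and> support f \<subseteq> {c + d * j | j. True})"

definition composition_scheme :: "setting \<Rightarrow> 'a comb_struct \<Rightarrow> 'b comb_struct \<Rightarrow> bool" where
  "composition_scheme s A B \<longleftrightarrow>
     comb_class s A \<and> comb_class s B \<and> slice B 0 = {} \<and>
     0 < fps_conv_radius (gf s A) \<and> fps_conv_radius (gf s A) < \<infinity> \<and>
     0 < fps_conv_radius (gf s B) \<and>
     0 < fps_conv_radius (gf s (composition s A B)) \<and> fps_conv_radius (gf s (composition s A B)) < \<infinity>"

definition supercritical :: "setting \<Rightarrow> 'a comb_struct \<Rightarrow> 'b comb_struct \<Rightarrow> bool" where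
  "supercritical s A B \<longleftrightarrow>
     fps_conv_radius (gf s (composition s A B)) < fps_conv_radius (gf s B)"

definition admissible_scheme :: "setting \<Rightarrow> 'a comb_struct \<Rightarrow> 'b comb_struct \<Rightarrow> bool" where
  "admissible_scheme s A B \<longleftrightarrow>
     composition_scheme s A B \<and> supercritical s A B \<and>
     \<not> periodic_series (gf s A) \<and> \<not> periodic_series (gf s B) \<and>
     \<not> periodic_series (gf s (composition s A B)) \<and>
     {k. k \<ge> 1} \<subseteq> support (gf s A)"


section \<open>Random generation procedures\<close>

text \<open>
  A procedure is the joint (sub)distribution of its output and its running time; the missing mass is
  the probability that it does not terminate.
\<close>

type_synonym 'x procedure = "('x \<times> nat) spmf"

definition boltzmann_sampler :: "setting \<Rightarrow> 'b comb_struct \<Rightarrow> real \<Rightarrow> 'b procedure \<Rightarrow> bool" where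
  "boltzmann_sampler s B x G \<longleftrightarrow>
     (\<forall>\<beta>. spmf (map_spmf fst G) \<beta> =
        (if \<beta> \<in> objs B
         then delta s (csize B \<beta>) * x ^ csize B \<beta> / eval_fps (gf s B) x else 0))"

definition exact_size_sampler :: "'a comb_struct \<Rightarrow> (nat \<Rightarrow> 'a procedure) \<Rightarrow> bool" where
  "exact_size_sampler A G \<longleftrightarrow>
     (\<forall>k. slice A k \<noteq> {} \<longrightarrow> map_spmf fst (G k) = spmf_of_set (slice A k))"

definition linear_time :: "'b comb_struct \<Rightarrow> 'b procedure \<Rightarrow> bool" where
  "linear_time B G \<longleftrightarrow> (\<exists>c::nat. \<forall>(\<beta>, t) \<in> set_spmf G. t \<le> c * csize B \<beta>)"

definition expected_time :: "'x procedure \<Rightarrow> ennreal" where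
  "expected_time G =
     (\<integral>\<^sup>+ r. (case r of None \<Rightarrow> \<top> | Some (x, t) \<Rightarrow> of_nat t) \<partial>measure_pmf G)"

text \<open>
  As \<open>T\<close> is real-valued, the expected time is finite for every admitted parameter, including the
  finitely many on which the asymptotic bound says nothing.
\<close>

definition linear_expected_time :: "nat set \<Rightarrow> (nat \<Rightarrow> 'x procedure) \<Rightarrow> bool" where
  "linear_expected_time N G \<longleftrightarrow>
     (\<exists>T :: nat \<Rightarrow> real. T \<in> O(\<lambda>n. real n) \<and> (\<forall>n \<in> N. expected_time (G n) \<le> ennreal (T n)))"


section \<open>The leap generator\<close>

text \<open>
  \<open>leap_trial B G m\<close> returns the list of the objects \<open>\<beta>\<^sub>1, \<dots>, \<beta>\<^sub>k\<close> for the largest \<open>k\<close> such that their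
  total size is at most \<open>m\<close>. As all sizes are positive, \<open>k\<close> is known as soon as the total size is
  \<open>m\<close>, or the next object (which is discarded, but whose generation is paid for) does not fit. The
  extra unit of time per generated object is for the bookkeeping.
\<close>

partial_function (spmf) leap_trial ::
  "'b comb_struct \<Rightarrow> 'b procedure \<Rightarrow> nat \<Rightarrow> 'b list procedure"
where
  "leap_trial B G m =
     (if m = 0 then return_spmf ([], 0)
      else bind_spmf G (\<lambda>(\<beta>, t).
        if csize B \<beta> > m then return_spmf ([], Suc t)
        else map_spmf (\<lambda>(\<beta>s, t'). (\<beta> # \<beta>s, Suc t + t')) (leap_trial B G (m - csize B \<beta>))))"

definition total_size :: "'b comb_struct \<Rightarrow> 'b list \<Rightarrow> nat" where
  "total_size B \<beta>s = (\<Sum>\<beta>\<leftarrow>\<beta>s. csize B \<beta>)"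

definition success_prob :: "'b comb_struct \<Rightarrow> 'b procedure \<Rightarrow> nat \<Rightarrow> real" where
  "success_prob B G n =
     measure (measure_spmf (leap_trial B G n)) {(\<beta>s, t). total_size B \<beta>s = n}"

text \<open>
  \<open>consecutive_blocks i [\<beta>\<^sub>1, \<dots>, \<beta>\<^sub>k]\<close> puts \<open>\<beta>\<^sub>1, \<dots>, \<beta>\<^sub>k\<close> on consecutive intervals of labels, starting
  after \<open>i\<close>. The labels are then permuted uniformly at random.
\<close>

fun consecutive_blocks :: "'b comb_struct \<Rightarrow> nat \<Rightarrow> 'b list \<Rightarrow> (nat set \<times> 'b) list" where
  "consecutive_blocks B i [] = []"
| "consecutive_blocks B i (\<beta> # \<beta>s) =
     ({i<..i + csize B \<beta>}, \<beta>) # consecutive_blocks B (i + csize B \<beta>) \<beta>s"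

fun assemble ::
  "setting \<Rightarrow> 'a comb_struct \<Rightarrow> 'b comb_struct \<Rightarrow> nat \<Rightarrow> 'a \<Rightarrow> 'b list \<Rightarrow> ('a, 'b) composite spmf"
where
  "assemble Unlabeled A B n \<alpha> \<beta>s = return_spmf (UComp \<alpha> \<beta>s)"
| "assemble Labeled A B n \<alpha> \<beta>s =
     map_spmf (\<lambda>\<pi>. relabel (composition Labeled A B) \<pi> (LComp \<alpha> (consecutive_blocks B 0 \<beta>s)))
       (spmf_of_set {\<pi>. \<pi> permutes {1..n}})"

text \<open>\<open>a n\<close> is the cost of the assembly and relabeling operations at size \<open>n\<close>.\<close>

partial_function (spmf) leap_generator ::
  "setting \<Rightarrow> 'a comb_struct \<Rightarrow> 'b comb_struct \<Rightarrow> (nat \<Rightarrow> 'a procedure) \<Rightarrow> 'b procedure \<Rightarrow>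
   (nat \<Rightarrow> nat) \<Rightarrow> nat \<Rightarrow> ('a, 'b) composite procedure"
where
  "leap_generator s A B GA GB a n =
     bind_spmf (leap_trial B GB n) (\<lambda>(\<beta>s, t).
       if total_size B \<beta>s = n then
         bind_spmf (GA (length \<beta>s)) (\<lambda>(\<alpha>, t').
           map_spmf (\<lambda>\<gamma>. (\<gamma>, t + t' + a n)) (assemble s A B n \<alpha> \<beta>s))
       else
         map_spmf (\<lambda>(\<gamma>, t'). (\<gamma>, t + t')) (leap_generator s A B GA GB a n))"

end

theory Submission
  imports Defs "HOL-Complex_Analysis.Cauchy_Integral_Formula"
begin

text \<open>
  The sizes of the objects that a trial draws are independent copies of a positive random variable
  with probability generating function \<open>p(z) = B(\<rho>z) / B(\<rho>)\<close>, and the trial succeeds at size \<open>n\<close> if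
  and only if one of the partial sums of these sizes equals \<open>n\<close>. So the success probabilities \<open>q\<^sub>n\<close>
  solve the renewal equation \<open>q\<^sub>0 = 1\<close>, \<open>q\<^sub>n = \<Sum>\<^sub>i p\<^sub>i q\<^sub>n\<^sub>-\<^sub>i\<close>, that is, \<open>\<Sum>\<^sub>n q\<^sub>n z\<^sup>n = 1 / (1 - p(z))\<close>
  (\<open>success_prob_renewal\<close>).

  Supercriticality makes \<open>p\<close> analytic in a disc of radius larger than \<open>1\<close>. On the closed unit disc,
  \<open>p(z) = 1\<close> forces \<open>z\<^sup>n = 1\<close> for all \<open>n\<close> in the support, hence \<open>z = 1\<close> by aperiodicity. So \<open>1 / (1 - p)\<close>
  has a simple pole at \<open>1\<close> and no further singularity in some larger disc, and the coefficients
  approach \<open>1 / p'(1) = 1 / \<mu>\<close> exponentially fast (\<open>renewal_exponential\<close>). Instead of the contour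
  integral that one would use for this transfer, the proof divides by \<open>1 - z\<close> on the level of power
  series: \<open>(f(1) - f(z)) / (1 - z)\<close> is the series of the tails of \<open>f\<close>, and it converges beyond the unit
  circle if \<open>f\<close> does. Applied to \<open>p\<close>, this removes the pole; applied to the reciprocal of the resulting
  series, it yields the series of the errors \<open>1 / \<mu> - q\<^sub>n\<close>.

  For the running time, a trial draws at most \<open>n\<close> objects, each at bounded expected cost because the
  mean size \<open>\<mu>\<close> is finite (\<open>expected_time_leap_trial\<close>). The number of trials is geometric with mean
  \<open>1 / q\<^sub>n\<close>, which is bounded as it tends to \<open>\<mu>\<close> (\<open>expected_time_restart\<close>); and the final call to the
  sampler of the core and the assembly are linear, since the core-size is at most \<open>n\<close>.
\<close>

section \<open>Exponential convergence in the renewal theorem\<close>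

text \<open>
  \<open>fps_tails f\<close> is \<open>(f(1) - f(z)) / (1 - z)\<close>: dividing the zero at \<open>1\<close> out of \<open>f(1) - f(z)\<close> sums
  the coefficients, so that the \<open>n\<close>-th coefficient is the tail of \<open>f(1)\<close> after the index \<open>n\<close>.
\<close>

definition fps_tails :: "'a :: {banach, real_normed_field} fps \<Rightarrow> 'a fps" where
  "fps_tails f = Abs_fps (\<lambda>n. eval_fps f 1 - (\<Sum>k\<le>n. fps_nth f k))"

lemma fps_tails_eq: "(1 - fps_X) * fps_tails f = fps_const (eval_fps f 1) - f"
proof (rule fps_ext)
  fix n
  show "fps_nth ((1 - fps_X) * fps_tails f) n = fps_nth (fps_const (eval_fps f 1) - f) n"
    by (cases n) (simp_all add: fps_tails_def algebra_simps)
qed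

text \<open>
  The singularity of the quotient at \<open>1\<close> is removable. On the level of coefficients: if
  \<open>\<Sum> |f\<^sub>k| R\<^sup>k = M\<close> converges for some \<open>R > 1\<close>, then the tail after the index \<open>n\<close> is at most \<open>M R\<^sup>-\<^sup>n\<close>.
\<close>

lemma fps_conv_radius_fps_tails:
  fixes f :: "'a :: {banach, real_normed_field} fps"
  assumes "fps_conv_radius f > 1"
  shows "fps_conv_radius (fps_tails f) > 1"
proof -
  obtain R where R: "1 < R" "ereal R < fps_conv_radius f"
    using ereal_dense2[OF assms] by (auto simp: one_ereal_def)
  define a where "a = (\<lambda>k. norm (fps_nth f k) * R ^ k)"
  have a: "summable a"
    using norm_summable_fps[of "of_real R" f] R by (simp add: a_def norm_mult norm_power)
  have nf: "summable (\<lambda>k. norm (fps_nth f k))"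
    using norm_summable_fps[of 1 f] assms by (simp add: one_ereal_def)
  have bound: "norm (fps_nth (fps_tails f) n) * R ^ n \<le> suminf a" for n
  proof -
    have s: "summable (\<lambda>k. norm (fps_nth f (k + Suc n)))"
      using nf by (subst summable_iff_shift)
    have "fps_nth (fps_tails f) n = (\<Sum>k. fps_nth f (k + Suc n))"
      using suminf_split_initial_segment[of "fps_nth f" "Suc n"] summable_norm_cancel[OF nf]
      by (simp add: fps_tails_def eval_fps_def lessThan_Suc_atMost)
    then have "norm (fps_nth (fps_tails f) n) * R ^ n \<le> (\<Sum>k. norm (fps_nth f (k + Suc n))) * R ^ n"
      using summable_norm[OF s] R by (intro mult_right_mono) auto
    also have "\<dots> = (\<Sum>k. norm (fps_nth f (k + Suc n)) * R ^ n)"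
      using suminf_mult2[OF s] by simp
    also have "\<dots> \<le> (\<Sum>k. a (k + Suc n))"
    proof (intro suminf_le allI)
      show "norm (fps_nth f (k + Suc n)) * R ^ n \<le> a (k + Suc n)" for k
        unfolding a_def using R by (intro mult_left_mono power_increasing) auto
      show "summable (\<lambda>k. norm (fps_nth f (k + Suc n)) * R ^ n)"
        using s by (rule summable_mult2)
      show "summable (\<lambda>k. a (k + Suc n))"
        using a by (subst summable_iff_shift)
    qed
    also have "\<dots> \<le> suminf a"
      using suminf_split_initial_segment[OF a, of "Suc n"] sum_nonneg[of "{..<Suc n}" a] R
      by (simp add: a_def)
    finally show ?thesis .
  qed
  have "ereal R \<le> fps_conv_radius (fps_tails f)"
    unfolding fps_conv_radius_def
  proof (rule conv_radius_geI_ex')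
    fix r assume r: "0 < r" "ereal r < ereal R"
    have "summable (\<lambda>n. norm (fps_nth (fps_tails f) n) * r ^ n)"
      using r bound by (intro Abel_lemma[where ?r0.0 = R]) auto
    then show "summable (\<lambda>n. fps_nth (fps_tails f) n * of_real r ^ n)"
      using r summable_norm_cancel[of "\<lambda>n. fps_nth (fps_tails f) n * of_real r ^ n"]
      by (simp add: norm_mult norm_power)
  qed
  moreover have "1 < ereal R" using R by (simp add: one_ereal_def)
  ultimately show ?thesis by (rule less_le_trans[rotated])
qed

lemma fps_nth_bigo_geometric:
  fixes f :: "'a :: {banach, real_normed_field} fps"
  assumes "fps_conv_radius f > 1"
  obtains r where "0 < r" "r < 1" "(\<lambda>n. norm (fps_nth f n)) \<in> O(\<lambda>n. r ^ n :: real)"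
proof -
  obtain R where R: "1 < R" "ereal R < fps_conv_radius f"
    using ereal_dense2[OF assms] by (auto simp: one_ereal_def)
  have "summable (\<lambda>k. norm (fps_nth f k) * R ^ k)"
    using norm_summable_fps[of "of_real R" f] R by (simp add: norm_mult norm_power)
  then have "Bseq (\<lambda>k. norm (fps_nth f k) * R ^ k)"
    by (intro convergent_imp_Bseq) (auto simp: convergent_def dest: summable_LIMSEQ_zero)
  then obtain M where M: "norm (fps_nth f k) * R ^ k \<le> M" for k
    using R by (auto simp: Bseq_def abs_mult)
  have "(\<lambda>n. norm (fps_nth f n)) \<in> O(\<lambda>n. (1 / R) ^ n)"
    using M R by (intro bigoI[of _ M]) (auto simp: field_simps)
  then show ?thesis using R that[of "1 / R"] by auto
qed

text \<open>
  The zeros of \<open>f\<close> in a slightly larger closed disc form a compact set. So if none of them is in the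
  closed unit disc, one of them has the least modulus, which exceeds \<open>1\<close>, and \<open>1 / f\<close> is analytic
  up to that modulus.
\<close>

lemma fps_conv_radius_inverse_gt_1:
  fixes f :: "complex fps"
  assumes "fps_conv_radius f > 1" and nz: "\<And>z. norm z \<le> 1 \<Longrightarrow> eval_fps f z \<noteq> 0"
  shows "fps_conv_radius (inverse f) > 1"
proof -
  obtain R where R: "1 < R" "ereal R < fps_conv_radius f"
    using ereal_dense2[OF assms(1)] by (auto simp: one_ereal_def)
  define Z where "Z = {z \<in> cball 0 R. eval_fps f z = 0}"
  have "continuous_on (cball 0 R) (eval_fps f)"
    using R(2) le_less_trans[of "ereal (norm x)" "ereal R" for x :: complex]
    by (intro continuous_on_subset[OF continuous_on_eval_fps]) auto
  then have "closed Z"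
    unfolding Z_def using continuous_closed_preimage_constant[of "cball 0 R" "eval_fps f" 0] by simp
  then have Zc: "compact Z"
    unfolding compact_eq_bounded_closed
    by (auto simp: Z_def intro: bounded_subset[of "cball 0 R"])
  have "\<exists>r>1. r \<le> R \<and> (\<forall>z. norm z < r \<longrightarrow> eval_fps f z \<noteq> 0)"
  proof (cases "Z = {}")
    case True
    then show ?thesis using R(1) by (intro exI[of _ R]) (auto simp: Z_def)
  next
    case False
    obtain w where w: "w \<in> Z" "\<And>z. z \<in> Z \<Longrightarrow> norm w \<le> norm z"
      using continuous_attains_inf[OF Zc False, of norm] by (auto intro: continuous_intros)
    have "norm w > 1" using nz[of w] w(1) by (force simp: Z_def)
    moreover have "norm w \<le> R" using w(1) by (simp add: Z_def)
    moreover have "eval_fps f z \<noteq> 0" if "norm z < norm w" for z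
      using w(2)[of z] that \<open>norm w \<le> R\<close> by (auto simp: Z_def)
    ultimately show ?thesis by blast
  qed
  then obtain r where r: "1 < r" "r \<le> R" "\<And>z. norm z < r \<Longrightarrow> eval_fps f z \<noteq> 0" by blast
  have "min (ereal r) (fps_conv_radius f) \<le> fps_conv_radius (inverse f)"
    using r by (intro fps_conv_radius_inverse) (auto simp: zero_ereal_def)
  moreover have "1 < min (ereal r) (fps_conv_radius f)"
    using r assms(1) by (auto simp: one_ereal_def)
  ultimately show ?thesis by (rule less_le_trans[rotated])
qed

text \<open>
  The coefficients are real throughout, but the location of the zeros is a question about complex
  arguments.
\<close>

definition complex_fps :: "real fps \<Rightarrow> complex fps" where
  "complex_fps p = Abs_fps (\<lambda>n. complex_of_real (fps_nth p n))"

lemma complex_fps_nth [simp]: "fps_nth (complex_fps p) n = of_real (fps_nth p n)"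
  by (simp add: complex_fps_def)

lemma complex_fps_mult: "complex_fps (p * q) = complex_fps p * complex_fps q"
  by (rule fps_ext) (simp add: fps_mult_nth)

lemma complex_fps_deriv: "fps_deriv (complex_fps p) = complex_fps (fps_deriv p)"
  by (rule fps_ext) simp

lemma fps_conv_radius_complex_fps: "fps_conv_radius (complex_fps p) = fps_conv_radius p"
  using conv_radius_norm[of "fps_nth p"] conv_radius_norm[of "fps_nth (complex_fps p)"]
  by (simp add: fps_conv_radius_def)

lemma eval_complex_fps:
  assumes "ereal \<bar>x\<bar> < fps_conv_radius p"
  shows "eval_fps (complex_fps p) (of_real x) = of_real (eval_fps p x)"
  using suminf_of_real[OF summable_fps[of x p], where 'a = complex] assms
  by (simp add: eval_fps_def)

text \<open>
  The divisor is the multiplicative order of \<open>z\<close>.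
\<close>

lemma power_eq_1_common_divisor:
  fixes z :: "'a :: {idom}"
  assumes "z \<noteq> 1" "n > 0" "z ^ n = 1"
  obtains d where "d \<ge> 2" "\<And>m. z ^ m = 1 \<Longrightarrow> d dvd m"
proof -
  define d where "d = (LEAST n. n > 0 \<and> z ^ n = 1)"
  have d: "d > 0" "z ^ d = 1"
    using LeastI[of "\<lambda>n. n > 0 \<and> z ^ n = 1" n] assms by (auto simp: d_def)
  have least: "d \<le> m" if "m > 0" "z ^ m = 1" for m
    using that by (auto simp: d_def intro: Least_le)
  have "d dvd m" if "z ^ m = 1" for m
  proof -
    have "z ^ m = (z ^ d) ^ (m div d) * z ^ (m mod d)"
      by (simp flip: power_mult power_add)
    then have "z ^ (m mod d) = 1" using that d by simp
    then show ?thesis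
      using least[of "m mod d"] d by (meson dvd_eq_mod_eq_0 mod_less_divisor not_gr0 not_le)
  qed
  moreover have "d \<noteq> 1" using d assms(1) by auto
  ultimately show ?thesis using d(1) that[of d] by auto
qed

text \<open>
  The value \<open>p(z) = 1\<close> is a convex combination of the points \<open>z\<^sup>n\<close> of the unit disc, and \<open>1\<close> is an
  extreme point of the disc. Hence \<open>z\<^sup>n = 1\<close> for all \<open>n\<close> in the support of \<open>p\<close>; a \<open>z \<noteq> 1\<close> with this
  property would have an order \<open>d \<ge> 2\<close> that divides the whole support.
\<close>

lemma aperiodic_eval_eq_1:
  fixes p :: "real fps"
  assumes nonneg: "\<And>n. fps_nth p n \<ge> 0"
    and rad: "fps_conv_radius p > 1" and one: "eval_fps p 1 = 1"
    and p0: "fps_nth p 0 = 0"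
    and aper: "\<And>d. d \<ge> 2 \<Longrightarrow> \<exists>n. fps_nth p n \<noteq> 0 \<and> \<not> d dvd n"
    and z: "norm z \<le> 1" "eval_fps (complex_fps p) z = 1"
  shows "z = 1"
proof (rule ccontr)
  assume "z \<noteq> 1"
  have sp: "fps_nth p sums 1"
    using sums_eval_fps[of 1 p] rad one by (simp add: one_ereal_def)
  have "ereal (norm z) < fps_conv_radius (complex_fps p)"
    using z(1) rad le_less_trans[of "ereal (norm z)" 1 "fps_conv_radius p"]
    by (simp add: fps_conv_radius_complex_fps one_ereal_def)
  then have "(\<lambda>n. of_real (fps_nth p n) * z ^ n) sums 1"
    using sums_eval_fps[of z "complex_fps p"] z(2) by simp
  then have "(\<lambda>n. fps_nth p n * Re (z ^ n)) sums 1"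
    using sums_Re by fastforce
  from sums_diff[OF sp this] have s0: "(\<lambda>n. fps_nth p n * (1 - Re (z ^ n))) sums 0"
    by (simp add: algebra_simps)
  have Re1: "Re (z ^ n) \<le> 1" for n
    using complex_Re_le_cmod[of "z ^ n"] power_le_one[of "norm z" n] z(1)
    by (simp add: norm_power)
  have zero: "fps_nth p n * (1 - Re (z ^ n)) = 0" for n
    using s0 suminf_eq_zero_iff[OF sums_summable[OF s0]] Re1 nonneg sums_unique[OF s0]
    by (metis diff_ge_0_iff_ge mult_nonneg_nonneg)
  have Re: "Re (z ^ n) = 1" if "fps_nth p n \<noteq> 0" for n
    using zero[of n] that by simp
  have zn: "z ^ n = 1" if "fps_nth p n \<noteq> 0" for n
  proof -
    have "(Re (z ^ n))\<^sup>2 + (Im (z ^ n))\<^sup>2 \<le> 1"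
      using power_le_one[of "norm z" n] z(1) by (simp flip: cmod_power2 add: norm_power abs_square_le_1)
    then show ?thesis using Re[OF that] by (simp add: complex_eq_iff)
  qed
  obtain n where n: "fps_nth p n \<noteq> 0"
    using aper[of 2] by auto
  then have "n > 0" using p0 by (cases n) auto
  from power_eq_1_common_divisor[OF \<open>z \<noteq> 1\<close> this zn[OF n]]
  obtain d where "d \<ge> 2" "\<And>m. z ^ m = 1 \<Longrightarrow> d dvd m" by blast
  then show False using aper[of d] zn by blast
qed

text \<open>
  The renewal theorem with exponential error term. As \<open>1\<close> is the only zero of \<open>1 - p(z)\<close> in the closed
  unit disc, \<open>H(z) = (1 - p(z)) / (1 - z)\<close> has no zero there, except possibly at \<open>1\<close>; but \<open>H(1) = p'(1)\<close>
  is the mean, which is positive. So \<open>g = 1 / H\<close> is analytic beyond the unit disc, and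
  \<open>1 / (1 - p(z)) = g(z) / (1 - z)\<close> has the partial sums of \<open>g(1) = 1 / p'(1)\<close> as its coefficients.
  Both \<open>H\<close> and the error terms are series of tails, of \<open>p\<close> and of \<open>g\<close>, respectively.
\<close>

theorem renewal_exponential:
  fixes p :: "real fps"
  assumes nonneg: "\<And>n. fps_nth p n \<ge> 0"
    and rad: "fps_conv_radius p > 1" and one: "eval_fps p 1 = 1"
    and p0: "fps_nth p 0 = 0"
    and aper: "\<And>d. d \<ge> 2 \<Longrightarrow> \<exists>n. fps_nth p n \<noteq> 0 \<and> \<not> d dvd n"
  shows "eval_fps (fps_deriv p) 1 > 0" 
    and "\<exists>r. 0 < r \<and> r < 1 \<and>
           (\<lambda>n. fps_nth (1 / (1 - p)) n - 1 / eval_fps (fps_deriv p) 1) \<in> O(\<lambda>n. r ^ n)"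
proof -
  define m where "m = eval_fps (fps_deriv p) 1"
  have rad': "fps_conv_radius (fps_deriv p) > 1"
    using rad fps_conv_radius_deriv[of p] by (rule less_le_trans)
  have m: "m > 0"
  proof -
    obtain n where n: "fps_nth p n \<noteq> 0" using aper[of 2] by auto
    then have n': "fps_nth p n > 0" "n > 0" using nonneg[of n] p0 by (auto intro: gr0I)
    show ?thesis
      unfolding m_def eval_fps_def
    proof (rule suminf_pos2[where i = "n - 1"])
      show "summable (\<lambda>n. fps_nth (fps_deriv p) n * 1 ^ n)"
        using rad' by (intro summable_fps) (simp add: one_ereal_def)
    qed (use nonneg n' in auto)
  qed
  then show "eval_fps (fps_deriv p) 1 > 0" by (simp add: m_def)
  define P where "P = complex_fps p"
  have P1: "eval_fps P 1 = 1"
    using eval_complex_fps[of 1 p] rad one by (simp add: P_def one_ereal_def)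
  have P'1: "eval_fps (fps_deriv P) 1 = of_real m"
    using eval_complex_fps[of 1 "fps_deriv p"] rad'
    by (simp add: P_def complex_fps_deriv m_def one_ereal_def)
  have radP: "fps_conv_radius P > 1"
    using rad by (simp add: P_def fps_conv_radius_complex_fps)
  define H where "H = fps_tails P"
  have radH: "fps_conv_radius H > 1"
    using fps_conv_radius_fps_tails[OF radP] by (simp add: H_def)
  have H: "(1 - fps_X) * H = 1 - P"
    by (simp add: H_def fps_tails_eq P1)
  have rad1X: "fps_conv_radius (1 - fps_X :: complex fps) = \<infinity>"
    using fps_conv_radius_diff[of "1 :: complex fps" fps_X] by simp
  \<comment> \<open>Differentiating \<open>(1 - z) H(z) = 1 - p(z)\<close> at \<open>z = 1\<close> gives \<open>- H(1) = - p'(1)\<close>.\<close>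
  have H1: "eval_fps H 1 = of_real m"
  proof -
    have radH': "fps_conv_radius (fps_deriv H) > 1"
      using radH fps_conv_radius_deriv[of H] by (rule less_le_trans)
    have "fps_deriv P = H - (1 - fps_X) * fps_deriv H"
      using arg_cong[OF H, of fps_deriv] by (simp add: algebra_simps)
    moreover have "fps_conv_radius ((1 - fps_X) * fps_deriv H) > 1"
      using less_le_trans[OF _ fps_conv_radius_mult[of "1 - fps_X" "fps_deriv H"], of 1] radH' rad1X
      by simp
    ultimately have "eval_fps (fps_deriv P) 1 = eval_fps H 1"
      using radH radH' rad1X
      by (simp add: eval_fps_diff eval_fps_mult one_ereal_def)
    then show ?thesis using P'1 by simp
  qed
  have Hnz: "eval_fps H z \<noteq> 0" if z: "norm z \<le> 1" for z
  proof (cases "z = 1")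
    case True
    then show ?thesis using H1 m by simp
  next
    case False
    have zr: "ereal (norm z) < fps_conv_radius H" "ereal (norm z) < fps_conv_radius P"
      using z radH radP le_less_trans[of "ereal (norm z)" 1] by (simp_all add: one_ereal_def)
    have "(1 - z) * eval_fps H z = 1 - eval_fps P z"
      using arg_cong[OF H, of "\<lambda>f. eval_fps f z"] zr rad1X
      by (simp add: eval_fps_mult eval_fps_diff)
    moreover have "eval_fps P z \<noteq> 1"
      using aperiodic_eval_eq_1[OF nonneg rad one p0 aper z] False by (auto simp: P_def)
    ultimately show ?thesis by auto
  qed
  define g where "g = inverse H"
  have radg: "fps_conv_radius g > 1"
    unfolding g_def using radH Hnz by (rule fps_conv_radius_inverse_gt_1)
  have "fps_nth H 0 \<noteq> 0"
    using Hnz[of 0] by (simp add: eval_fps_at_0)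
  then have gH: "g * H = 1"
    by (simp add: g_def inverse_mult_eq_1)
  have g1: "eval_fps g 1 = 1 / of_real m"
    using arg_cong[OF gH, of "\<lambda>f. eval_fps f 1"] radg radH H1 m
    by (simp add: eval_fps_mult one_ereal_def field_simps)
  \<comment> \<open>\<open>K\<close> is the series of the error terms: \<open>K = 1 / (m (1 - z)) - 1 / (1 - p)\<close>.\<close>
  define K where "K = fps_tails g"
  have radK: "fps_conv_radius K > 1"
    using fps_conv_radius_fps_tails[OF radg] by (simp add: K_def)
  have K: "(1 - fps_X) * K = fps_const (1 / of_real m) - g"
    by (simp add: K_def fps_tails_eq g1)
  define q where "q = 1 / (1 - p)"
  define Q where "Q = complex_fps q"
  have "q * (1 - p) = 1"
    unfolding q_def using p0 by (simp add: fps_divide_unit inverse_mult_eq_1)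
  moreover have "complex_fps (1 - p) = 1 - P" "complex_fps 1 = 1"
    by (simp_all add: P_def fps_eq_iff fps_one_nth)
  ultimately have "Q * (1 - P) = 1"
    by (metis Q_def complex_fps_mult)
  then have QP: "Q * ((1 - fps_X) * H) = 1"
    by (simp only: H)
  have "(1 - fps_X) * Q = (g * H) * ((1 - fps_X) * Q)"
    by (simp only: gH mult_1_left)
  also have "\<dots> = g * (Q * ((1 - fps_X) * H))"
    by (simp only: mult_ac)
  also have "\<dots> = g"
    by (simp only: QP mult_1_right)
  finally have Q: "(1 - fps_X) * Q = g" .
  define G where "G = Abs_fps (\<lambda>_. 1 :: complex)"
  have G: "(1 - fps_X) * G = 1"
    by (rule fps_ext) (auto simp: G_def algebra_simps fps_X_mult_nth)
  have "(1 - fps_X) * (fps_const (1 / of_real m) * G - Q) =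
      fps_const (1 / of_real m) * ((1 - fps_X) * G) - (1 - fps_X) * Q"
    by (simp only: right_diff_distrib mult.left_commute)
  also have "\<dots> = (1 - fps_X) * K"
    by (simp only: K Q G mult_1_right)
  finally have "(1 - fps_X) * (fps_const (1 / of_real m) * G - Q) = (1 - fps_X) * K" .
  moreover have "(1 - fps_X :: complex fps) \<noteq> 0"
    by (metis G mult_zero_left zero_neq_one)
  ultimately have "K = fps_const (1 / of_real m) * G - Q"
    by (metis mult_left_cancel)
  then have Kn: "fps_nth K n = of_real (1 / m - fps_nth q n)" for n
    by (simp add: G_def Q_def)
  obtain r where r: "0 < r" "r < 1" "(\<lambda>n. norm (fps_nth K n)) \<in> O(\<lambda>n. r ^ n)"
    using fps_nth_bigo_geometric[OF radK] .
  have "(\<lambda>n. fps_nth q n - 1 / m) \<in> O(\<lambda>n. r ^ n)"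
    using r(3) unfolding Kn norm_of_real
    by (subst (asm) landau_o.big.abs_in_iff, subst landau_o.big.uminus_in_iff[symmetric]) simp
  with r show "\<exists>r. 0 < r \<and> r < 1 \<and>
           (\<lambda>n. fps_nth (1 / (1 - p)) n - 1 / eval_fps (fps_deriv p) 1) \<in> O(\<lambda>n. r ^ n)"
    unfolding q_def m_def by blast
qed

section \<open>Expected running time of restarted procedures\<close>

lemma emeasure_lossless_spmf:
  assumes "lossless_spmf p"
  shows "emeasure (measure_spmf p) UNIV = 1"
  using assms by (simp add: lossless_spmf_def weight_spmf_def measure_spmf.emeasure_eq_measure)

lemma prob_space_lossless_spmf:
  assumes "lossless_spmf p"
  shows "prob_space (measure_spmf p)"
  using emeasure_lossless_spmf[OF assms] by (intro prob_spaceI) (simp add: space_measure_spmf)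

lemma nn_integral_bind_spmf:
  "(\<integral>\<^sup>+ z. g z \<partial>measure_spmf (bind_spmf p f)) = (\<integral>\<^sup>+ x. \<integral>\<^sup>+ z. g z \<partial>measure_spmf (f x) \<partial>measure_spmf p)"
  unfolding measure_spmf_bind
  by (subst nn_integral_bind[where B = "count_space UNIV"]) (auto simp: o_def)

lemma expected_time_lossless:
  assumes "lossless_spmf G"
  shows "expected_time G = (\<integral>\<^sup>+ (x, t). of_nat t \<partial>measure_spmf G)"
proof -
  obtain G' where G: "G = spmf_of_pmf G'"
    using assms lossless_spmf_conv_spmf_of_pmf by blast
  have "expected_time G = (\<integral>\<^sup>+ (x, t). of_nat t \<partial>measure_pmf G')"
    by (simp add: G expected_time_def spmf_of_pmf_def nn_integral_map_pmf)
  then show ?thesis by (simp add: G)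
qed

text \<open>
  The weight \<open>w\<close> of a procedure that is restarted after a failure satisfies \<open>w = q + (1 - q) w\<close>,
  where \<open>q\<close> is the probability of success. This forces \<open>w = 1\<close> if \<open>q > 0\<close>. Termination has to come
  first, because a positive probability of running forever makes the expected time infinite.
\<close>

lemma lossless_restart:
  assumes L: "L = bind_spmf R (\<lambda>(y, t). if S y then map_spmf (\<lambda>(x, t'). (x, t + t')) (F y)
                                     else map_spmf (\<lambda>(x, t'). (x, t + t')) L)"
    and R: "lossless_spmf R"
    and F: "\<And>y t. (y, t) \<in> set_spmf R \<Longrightarrow> S y \<Longrightarrow> lossless_spmf (F y)"
    and q: "measure (measure_spmf R) {(y, t). S y} > 0"
  shows "lossless_spmf L"
proof -
  define w where "w = weight_spmf L"
  define q where "q = measure (measure_spmf R) {(y, t). S y}"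
  interpret R: prob_space "measure_spmf R"
    using R by (rule prob_space_lossless_spmf)
  have "w = (\<integral>z. weight_spmf (case z of (y, t) \<Rightarrow>
              if S y then map_spmf (\<lambda>(x, t'). (x, t + t')) (F y)
              else map_spmf (\<lambda>(x, t'). (x, t + t')) L) \<partial>measure_spmf R)"
    using arg_cong[OF L, of weight_spmf] by (simp only: w_def weight_bind_spmf o_def)
  also have "\<dots> = (\<integral>z. w + (1 - w) * indicator {(y, t). S y} z \<partial>measure_spmf R)"
    using F by (intro integral_cong_AE)
       (auto simp: w_def lossless_weight_spmfD split: split_indicator)
  also have "\<dots> = w + (1 - w) * q"
  proof -
    have "integrable (measure_spmf R) (indicator {(y, t). S y} :: _ \<Rightarrow> real)"
      by (rule integrable_real_indicator) (auto simp: measure_spmf.emeasure_eq_measure)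
    then show ?thesis
      by (simp add: q_def R.prob_space[unfolded space_measure_spmf] space_measure_spmf)
  qed
  finally have "(1 - w) * q = 0" by simp
  then show ?thesis
    using q by (simp add: lossless_spmf_def w_def q_def)
qed

text \<open>
  Wald's identity, as an upper bound: the expected number of trials is \<open>1 / q\<close>, and only the last one
  is followed by \<open>F\<close>, whose cost is nevertheless charged to every trial. The recursion gives
  \<open>x \<le> a + b + (1 - q) x\<close> for the expected time \<open>x\<close>, which bounds \<open>x\<close> only if \<open>x\<close> is known to be
  finite. So the inequality is applied to the running time truncated at \<open>M\<close>, followed by monotone
  convergence as \<open>M\<close> grows.
\<close>

lemma expected_time_restart:
  assumes L: "L = bind_spmf R (\<lambda>(y, t). if S y then map_spmf (\<lambda>(x, t'). (x, t + t')) (F y)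
                                     else map_spmf (\<lambda>(x, t'). (x, t + t')) L)"
    and R: "lossless_spmf R"
    and F: "\<And>y t. (y, t) \<in> set_spmf R \<Longrightarrow> S y \<Longrightarrow> lossless_spmf (F y)"
    and q: "q = measure (measure_spmf R) {(y, t). S y}" "q > 0"
    and a: "expected_time R \<le> ennreal a" "a \<ge> 0"
    and b: "\<And>y t. (y, t) \<in> set_spmf R \<Longrightarrow> S y \<Longrightarrow> expected_time (F y) \<le> ennreal b" "b \<ge> 0"
  shows "expected_time L \<le> ennreal ((a + b) / q)"
proof -
  have lossless: "lossless_spmf L"
    using lossless_restart[OF L R F] q by simp
  interpret R: prob_space "measure_spmf R"
    using R by (rule prob_space_lossless_spmf)
  define x where "x = (\<lambda>M. \<integral>\<^sup>+ (z, t). ennreal (real (min t M)) \<partial>measure_spmf L)"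
  have fail: "emeasure (measure_spmf R) {(y, t). \<not> S y} = ennreal (1 - q)"
  proof -
    have "measure (measure_spmf R) (UNIV - {(y, t). S y}) = 1 - q"
      using R.prob_compl[of "{(y, t). S y}"] by (simp add: space_measure_spmf q)
    also have "UNIV - {(y, t). S y} = {(y, t). \<not> S y}" by auto
    finally show ?thesis by (simp add: measure_spmf.emeasure_eq_measure)
  qed
  have bound: "x M \<le> ennreal ((a + b) / q)" for M
  proof -
    have "x M \<le> (\<integral>\<^sup>+ (z, t). ennreal (real M) \<partial>measure_spmf L)"
      unfolding x_def by (intro nn_integral_mono) auto
    also have "\<dots> \<le> ennreal (real M)"
      using subprob_space.emeasure_space_le_1[OF subprob_space_measure_spmf, of L]
      by (simp add: space_measure_spmf case_prod_beta' mult_left_le)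
    finally obtain x' where x': "x M = ennreal x'" "x' \<ge> 0"
      by (metis ennreal_cases ennreal_less_top leD top.extremum_strict le_less_trans not_le)
    have "x M = (\<integral>\<^sup>+ (y, t). (if S y then \<integral>\<^sup>+ (z, t'). ennreal (real (min (t + t') M)) \<partial>measure_spmf (F y)
                   else \<integral>\<^sup>+ (z, t'). ennreal (real (min (t + t') M)) \<partial>measure_spmf L) \<partial>measure_spmf R)"
      unfolding x_def
      by (subst L, subst nn_integral_bind_spmf) (auto simp: case_prod_beta o_def intro!: nn_integral_cong)
    also have "\<dots> \<le> (\<integral>\<^sup>+ (y, t). of_nat t + (ennreal b + x M * indicator {(y, t). \<not> S y} (y, t))
                      \<partial>measure_spmf R)"
    proof (intro nn_integral_mono_AE, unfold AE_measure_spmf_iff, safe)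
      fix y t assume yt: "(y, t) \<in> set_spmf R"
      \<comment> \<open>Truncation is subadditive: \<open>min (t + t') M \<le> t + min t' M\<close>.\<close>
      have split: "(\<integral>\<^sup>+ (z, t'). ennreal (real (min (t + t') M)) \<partial>measure_spmf K)
             \<le> of_nat t + (\<integral>\<^sup>+ (z, t'). ennreal (real (min t' M)) \<partial>measure_spmf K)" for K :: "'a procedure"
      proof -
        have "(\<integral>\<^sup>+ (z, t'). ennreal (real (min (t + t') M)) \<partial>measure_spmf K)
            \<le> (\<integral>\<^sup>+ (z, t'). of_nat t + ennreal (real (min t' M)) \<partial>measure_spmf K)"
          by (intro nn_integral_mono)
             (auto simp: ennreal_of_nat_eq_real_of_nat simp flip: ennreal_plus intro!: ennreal_leI)
        also have "\<dots> = of_nat t * emeasure (measure_spmf K) UNIV +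
              (\<integral>\<^sup>+ (z, t'). ennreal (real (min t' M)) \<partial>measure_spmf K)"
          by (simp add: case_prod_beta' nn_integral_add space_measure_spmf)
        also have "\<dots> \<le> of_nat t + (\<integral>\<^sup>+ (z, t'). ennreal (real (min t' M)) \<partial>measure_spmf K)"
          using subprob_space.emeasure_space_le_1[OF subprob_space_measure_spmf, of K]
          by (intro add_right_mono) (simp add: space_measure_spmf mult_left_le)
        finally show ?thesis .
      qed
      show "(if S y then \<integral>\<^sup>+ (z, t'). ennreal (real (min (t + t') M)) \<partial>measure_spmf (F y)
             else \<integral>\<^sup>+ (z, t'). ennreal (real (min (t + t') M)) \<partial>measure_spmf L)
            \<le> of_nat t + (ennreal b + x M * indicator {(y, t). \<not> S y} (y, t))"
      proof (cases "S y")
        case True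
        have "(\<integral>\<^sup>+ (z, t'). ennreal (real (min t' M)) \<partial>measure_spmf (F y)) \<le> expected_time (F y)"
          unfolding expected_time_lossless[OF F[OF yt True]]
          by (intro nn_integral_mono) (auto simp: ennreal_of_nat_eq_real_of_nat)
        also have "\<dots> \<le> ennreal b" by (rule b(1)[OF yt True])
        finally show ?thesis
          using True by (auto intro!: order.trans[OF split] add_left_mono)
      next
        case False
        have "(\<integral>\<^sup>+ (z, t'). ennreal (real (min t' M)) \<partial>measure_spmf L) \<le> ennreal b + x M"
          unfolding x_def by (rule add_increasing) auto
        then show ?thesis
          using False by (auto intro!: order.trans[OF split] add_left_mono)
      qed
    qed
    also have "\<dots> = expected_time R + (ennreal b + x M * ennreal (1 - q))"
      by (simp add: case_prod_beta' nn_integral_add nn_integral_cmult fail[unfolded case_prod_beta'] expected_time_lossless[OF R]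
            R.emeasure_space_1[unfolded space_measure_spmf] space_measure_spmf)
    also have "\<dots> \<le> ennreal a + (ennreal b + ennreal x' * ennreal (1 - q))"
      using a(1) x' by (intro add_mono) auto
    also have "\<dots> = ennreal (a + (b + x' * (1 - q)))"
      using a(2) b(2) x' R.prob_le_1[of "{(y, t). S y}"]
      by (simp add: ennreal_mult ennreal_plus q)
    finally have le: "x M \<le> ennreal (a + (b + x' * (1 - q)))" .
    have "0 \<le> a + (b + x' * (1 - q))"
      using a(2) b(2) x' R.prob_le_1[of "{(y, t). S y}"] by (simp add: q)
    with le have "x' \<le> a + (b + x' * (1 - q))"
      by (simp only: x'(1) ennreal_le_iff)
    then have "x' \<le> (a + b) / q"
      using q(2) by (simp add: field_simps)
    then show ?thesis by (simp add: x' ennreal_leI)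
  qed
  have "expected_time L = (\<integral>\<^sup>+ z. (SUP M. ennreal (real (min (snd z) M))) \<partial>measure_spmf L)"
    unfolding expected_time_lossless[OF lossless] case_prod_beta
  proof (intro nn_integral_cong antisym SUP_least)
    fix z :: "'a \<times> nat"
    show "of_nat (snd z) \<le> (SUP M. ennreal (real (min (snd z) M)))"
      by (rule SUP_upper2[of "snd z"]) (auto simp: ennreal_of_nat_eq_real_of_nat)
  qed (auto simp: ennreal_of_nat_eq_real_of_nat)
  also have "\<dots> = (SUP M. x M)"
    unfolding x_def case_prod_beta
    by (rule nn_integral_monotone_convergence_SUP) (auto simp: incseq_def le_fun_def)
  also have "\<dots> \<le> ennreal ((a + b) / q)"
    using bound by (rule SUP_least)
  finally show ?thesis .
qed

section \<open>A single trial as a renewal process\<close>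

text \<open>
  The sizes of the objects are the steps of a renewal process; a trial succeeds at \<open>m\<close> if and only if
  \<open>m\<close> is a renewal epoch. Positive steps make the recursion of \<open>leap_trial\<close> well-founded.
\<close>

locale positive_size_sampler =
  fixes B :: "'b comb_struct" and G :: "'b procedure"
  assumes lossless: "lossless_spmf G"
    and size_pos: "(\<beta>, t) \<in> set_spmf G \<Longrightarrow> csize B \<beta> > 0"
begin

abbreviation size_spmf :: "nat spmf" where
  "size_spmf \<equiv> map_spmf (\<lambda>(\<beta>, t). csize B \<beta>) G"

lemma total_size_Cons [simp]: "total_size B (\<beta> # \<beta>s) = csize B \<beta> + total_size B \<beta>s"
  and total_size_Nil [simp]: "total_size B [] = 0"
  by (simp_all add: total_size_def)

lemma lossless_leap_trial: "lossless_spmf (leap_trial B G m)"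
proof (induction m rule: less_induct)
  case (less m)
  show ?case
    using lossless size_pos
    by (subst leap_trial.simps) (auto intro!: less.IH)
qed

text \<open>
  As every object has at least one atom, the core-size of the output is at most its size, so that a
  cost linear in the core-size is also linear in the size.
\<close>

lemma set_leap_trial:
  "(\<beta>s, t) \<in> set_spmf (leap_trial B G m) \<Longrightarrow> length \<beta>s \<le> total_size B \<beta>s"
proof (induction m arbitrary: \<beta>s t rule: less_induct)
  case (less m)
  show ?case
  proof (cases "m = 0")
    case True
    then show ?thesis using less.prems by (subst (asm) leap_trial.simps) auto
  next
    case False
    with less.prems obtain \<beta> t0 where b: "(\<beta>, t0) \<in> set_spmf G"
      and *: "(\<beta>s, t) \<in> set_spmf (if csize B \<beta> > m then return_spmf ([], Suc t0)
        else map_spmf (\<lambda>(\<beta>s, t'). (\<beta> # \<beta>s, Suc t0 + t')) (leap_trial B G (m - csize B \<beta>)))"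
      by (subst (asm) leap_trial.simps) (auto simp: set_bind_spmf)
    show ?thesis
    proof (cases "csize B \<beta> > m")
      case True
      then show ?thesis using * by simp
    next
      case 2: False
      with * obtain \<beta>s' t' where "\<beta>s = \<beta> # \<beta>s'" "(\<beta>s', t') \<in> set_spmf (leap_trial B G (m - csize B \<beta>))"
        by auto
      then show ?thesis
        using less.IH[of "m - csize B \<beta>" \<beta>s' t'] size_pos[OF b] False by auto
    qed
  qed
qed

lemma success_prob_0: "success_prob B G 0 = 1"
  unfolding success_prob_def
  by (subst leap_trial.simps) (simp add: measure_spmf_return_spmf measure_return)

text \<open>
  The renewal equation, obtained by conditioning on the size of the first object.
\<close>

lemma success_prob_rec:
  assumes "m > 0"
  shows "success_prob B G m = (\<Sum>i\<le>m. spmf size_spmf i * success_prob B G (m - i))"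
proof -
  have eq: "success_prob B G k = spmf (map_spmf (\<lambda>(\<beta>s, t). total_size B \<beta>s = k) (leap_trial B G k)) True" for k
    by (simp add: success_prob_def spmf_map vimage_def case_prod_beta')
  define h where "h = (\<lambda>i. if i > m then 0 else success_prob B G (m - i))"
  have "map_spmf (\<lambda>(\<beta>s, t). total_size B \<beta>s = m) (leap_trial B G m) =
     bind_spmf G (\<lambda>(\<beta>, t). if csize B \<beta> > m then return_spmf False
        else map_spmf (\<lambda>(\<beta>s, t). total_size B \<beta>s = m - csize B \<beta>) (leap_trial B G (m - csize B \<beta>)))"
    using assms
    by (subst leap_trial.simps)
       (auto simp: map_spmf_bind_spmf spmf.map_comp o_def case_prod_beta' intro!: bind_spmf_cong map_spmf_cong)
  then have "success_prob B G m = (\<integral>(\<beta>, t). h (csize B \<beta>) \<partial>measure_spmf G)"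
    by (auto simp: eq[of m] spmf_bind h_def case_prod_beta' eq intro!: Bochner_Integration.integral_cong)
  also have "\<dots> = (\<integral>i. h i \<partial>measure_spmf size_spmf)"
    by (simp add: measure_map_spmf_conv_distr integral_distr case_prod_beta')
  also have "\<dots> = (\<Sum>i\<le>m. spmf size_spmf i * h i)"
  proof -
    have h_sum: "h i = (\<Sum>j\<le>m. h j * indicator {j} i)" for i
    proof -
      have "(\<Sum>j\<le>m. h j * indicator {j} i) = (\<Sum>j\<le>m. if i = j then h j else 0)"
        by (intro sum.cong) (auto simp: indicator_def)
      then show ?thesis by (simp add: h_def)
    qed
    have "(\<integral>i. h i \<partial>measure_spmf size_spmf) =
        (\<integral>i. (\<Sum>j\<le>m. h j * indicator {j} i) \<partial>measure_spmf size_spmf)"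
      by (rule Bochner_Integration.integral_cong[OF refl h_sum])
    also have "\<dots> = (\<Sum>j\<le>m. \<integral>i. h j * indicator {j} i \<partial>measure_spmf size_spmf)"
      by (intro Bochner_Integration.integral_sum integrable_mult_right integrable_real_indicator)
         (auto simp: measure_spmf.emeasure_eq_measure)
    also have "\<dots> = (\<Sum>j\<le>m. spmf size_spmf j * h j)"
      by (simp add: spmf_conv_measure_spmf space_measure_spmf mult.commute)
    finally show ?thesis .
  qed
  also have "\<dots> = (\<Sum>i\<le>m. spmf size_spmf i * success_prob B G (m - i))"
    by (intro sum.cong) (auto simp: h_def)
  finally show ?thesis .
qed

lemma size_spmf_0: "spmf size_spmf 0 = 0"
  using size_pos by (fastforce simp: spmf_eq_0_set_spmf)

theorem success_prob_renewal:
  "success_prob B G n = fps_nth (1 / (1 - Abs_fps (spmf size_spmf))) n"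
proof -
  define p where "p = Abs_fps (spmf size_spmf)"
  define q where "q = Abs_fps (success_prob B G)"
  have p0: "fps_nth p 0 = 0" by (simp add: p_def size_spmf_0)
  have "q = 1 + p * q"
  proof (rule fps_ext)
    fix n
    show "fps_nth q n = fps_nth (1 + p * q) n"
      by (cases "n = 0")
         (simp_all add: q_def p_def success_prob_0 success_prob_rec fps_mult_nth size_spmf_0 atLeast0AtMost)
  qed
  then have "q * (1 - p) = 1" by (simp add: algebra_simps)
  moreover have "1 / (1 - p) = inverse (1 - p)" "(1 - p) * inverse (1 - p) = 1"
    using p0 by (simp_all add: fps_divide_unit inverse_mult_eq_1')
  ultimately have "q = 1 / (1 - p)"
    by (metis mult.assoc mult.left_neutral mult.right_neutral)
  then show ?thesis by (metis q_def p_def fps_nth_Abs_fps)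
qed

lemma success_prob_pos:
  assumes "\<And>\<beta>. \<beta> \<in> set \<beta>s \<Longrightarrow> spmf size_spmf (csize B \<beta>) > 0"
  shows "success_prob B G (total_size B \<beta>s) > 0"
  using assms
proof (induction \<beta>s)
  case Nil
  then show ?case by (simp add: success_prob_0)
next
  case (Cons \<beta> \<beta>s)
  let ?i = "csize B \<beta>" and ?m = "csize B \<beta> + total_size B \<beta>s"
  have pos: "spmf size_spmf ?i > 0" using Cons.prems by simp
  then have "?i > 0" using size_spmf_0 by (cases "?i = 0") auto
  have "0 < spmf size_spmf ?i * success_prob B G (?m - ?i)"
    using Cons pos by simp
  also have "\<dots> \<le> (\<Sum>i\<le>?m. spmf size_spmf i * success_prob B G (?m - i))"
    by (rule member_le_sum[where f = "\<lambda>i. spmf size_spmf i * success_prob B G (?m - i)"])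
       (auto simp: success_prob_def)
  finally show ?case
    using success_prob_rec[of ?m] \<open>?i > 0\<close> by simp
qed

text \<open>
  A trial at \<open>m\<close> draws at most \<open>m\<close> objects, each at expected cost at most \<open>1 + c \<mu>\<close>, where \<open>\<mu>\<close> is the
  mean size. The object that does not fit is included in this count.
\<close>

lemma expected_time_leap_trial:
  assumes lin: "\<And>\<beta> t. (\<beta>, t) \<in> set_spmf G \<Longrightarrow> t \<le> c * csize B \<beta>"
  shows "expected_time (leap_trial B G m) \<le>
           of_nat m * (1 + of_nat c * (\<integral>\<^sup>+ i. of_nat i \<partial>measure_spmf size_spmf))"
proof (induction m rule: less_induct)
  case (less m)
  let ?\<mu> = "\<integral>\<^sup>+ i. of_nat i \<partial>measure_spmf size_spmf :: ennreal"
  let ?K = "1 + of_nat c * ?\<mu>"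
  note E = expected_time_lossless[OF lossless_leap_trial]
  show ?case
  proof (cases "m = 0")
    case True
    then show ?thesis
      by (simp add: E) (subst leap_trial.simps, simp add: measure_spmf_return_spmf nn_integral_return)
  next
    case False
    note emG = emeasure_lossless_spmf[OF lossless]
    have "expected_time (leap_trial B G m) =
       (\<integral>\<^sup>+ (\<beta>, t). \<integral>\<^sup>+ (\<beta>s, t'). of_nat t' \<partial>measure_spmf
           (if csize B \<beta> > m then return_spmf ([], Suc t)
            else map_spmf (\<lambda>(\<beta>s, t'). (\<beta> # \<beta>s, Suc t + t')) (leap_trial B G (m - csize B \<beta>)))
         \<partial>measure_spmf G)"
      unfolding E using False
      by (subst leap_trial.simps) (simp add: nn_integral_bind_spmf case_prod_beta')
    \<comment> \<open>After the first object at most \<open>m - 1\<close> atoms are left, whether or not it fits.\<close>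
    also have "\<dots> \<le> (\<integral>\<^sup>+ (\<beta>, t). of_nat c * of_nat (csize B \<beta>) + (1 + of_nat (m - 1) * ?K) \<partial>measure_spmf G)"
    proof (intro nn_integral_mono_AE, unfold AE_measure_spmf_iff, safe)
      fix \<beta> t assume bt: "(\<beta>, t) \<in> set_spmf G"
      have t: "of_nat (Suc t) \<le> of_nat c * of_nat (csize B \<beta>) + (1 :: ennreal)"
        using lin[OF bt] by (simp flip: of_nat_mult of_nat_Suc add: add.commute)
      show "(\<integral>\<^sup>+ (\<beta>s, t'). of_nat t' \<partial>measure_spmf
           (if csize B \<beta> > m then return_spmf ([], Suc t)
            else map_spmf (\<lambda>(\<beta>s, t'). (\<beta> # \<beta>s, Suc t + t')) (leap_trial B G (m - csize B \<beta>))))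
          \<le> of_nat c * of_nat (csize B \<beta>) + (1 + of_nat (m - 1) * ?K)"
      proof (cases "csize B \<beta> > m")
        case True
        then show ?thesis
          using t by (auto simp: measure_spmf_return_spmf nn_integral_return add.assoc[symmetric] intro: add_increasing2)
      next
        case 2: False
        let ?L = "leap_trial B G (m - csize B \<beta>)"
        note em = emeasure_lossless_spmf[OF lossless_leap_trial[of "m - csize B \<beta>"]]
        have "(\<integral>\<^sup>+ (\<beta>s, t'). of_nat t' \<partial>measure_spmf (map_spmf (\<lambda>(\<beta>s, t'). (\<beta> # \<beta>s, Suc t + t')) ?L)) =
           (\<integral>\<^sup>+ (\<beta>s, t'). of_nat (Suc t) + of_nat t' \<partial>measure_spmf ?L)"
          by (simp add: o_def case_prod_beta' add.assoc)
        also have "\<dots> = of_nat (Suc t) + expected_time ?L"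
          unfolding E case_prod_beta'
          by (subst nn_integral_add) (simp_all add: space_measure_spmf em del: of_nat_Suc)
        also have "\<dots> \<le> of_nat (Suc t) + of_nat (m - csize B \<beta>) * ?K"
          using 2 size_pos[OF bt] by (intro add_left_mono less.IH) auto
        also have "\<dots> \<le> (of_nat c * of_nat (csize B \<beta>) + 1) + of_nat (m - 1) * ?K"
          using size_pos[OF bt] by (intro add_mono t mult_right_mono) auto
        finally show ?thesis using 2 by (simp add: add.assoc)
      qed
    qed
    also have "\<dots> = of_nat c * ?\<mu> + (1 + of_nat (m - 1) * ?K)"
      by (simp add: case_prod_beta' nn_integral_add nn_integral_cmult space_measure_spmf emG o_def)
    also have "\<dots> = of_nat (Suc (m - 1)) * ?K"
      by (simp add: algebra_simps)
    also have "Suc (m - 1) = m" using False by simp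
    finally show ?thesis .
  qed
qed

end

section \<open>Components of composite objects\<close>

text \<open>
  The two settings share a core and a list of components, one for each atom of the core; the sizes
  of the components determine the size of the composite object.
\<close>

lemma composition_components:
  assumes "\<gamma> \<in> slice (composition s A B) n"
  obtains \<alpha> \<beta>s where "\<alpha> \<in> slice A (length \<beta>s)" "set \<beta>s \<subseteq> objs B" "total_size B \<beta>s = n"
proof (cases s)
  case Unlabeled
  then obtain \<alpha> \<beta>s where \<gamma>: "\<gamma> = UComp \<alpha> \<beta>s"
    and "\<alpha> \<in> slice A (length \<beta>s)" "set \<beta>s \<subseteq> objs B"
    using assms by (auto simp: slice_def composition_def)
  moreover have "total_size B \<beta>s = n"
    using assms \<gamma> by (simp add: slice_def composition_def total_size_def)
  ultimately show ?thesis using that by blast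
next
  case Labeled
  then obtain \<alpha> bs where \<gamma>: "\<gamma> = LComp \<alpha> bs" and "\<alpha> \<in> slice A (length (map snd bs))"
    and bs: "\<forall>(L, \<beta>) \<in> set bs. \<beta> \<in> objs B \<and> card L = csize B \<beta>"
    using assms by (auto simp: slice_def composition_def)
  moreover have "set (map snd bs) \<subseteq> objs B" using bs by auto
  moreover have "total_size B (map snd bs) = n"
    using assms \<gamma> by (simp add: slice_def composition_def total_size_def o_def case_prod_beta')
  ultimately show ?thesis using that by blast
qed

section \<open>The size distribution of a Boltzmann sampler\<close>

text \<open>
  The Boltzmann distribution at a parameter strictly inside the disc of convergence: this is where
  supercriticality enters, as it gives the size distribution an exponential moment.
\<close>

locale boltzmann =
  fixes s :: setting and B :: "'b comb_struct" and \<rho> :: real and G :: "'b procedure"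
  assumes comb_class: "comb_class s B"
    and slice_0: "slice B 0 = {}"
    and aperiodic: "\<not> periodic_series (gf s B)"
    and rho: "\<rho> > 0" "ereal \<rho> < fps_conv_radius (gf s B)"
    and sampler: "boltzmann_sampler s B \<rho> G"
begin

text \<open>
  The probability generating function of the size under the Boltzmann distribution.
\<close>

definition size_gf :: "real fps" where
  "size_gf = fps_const (1 / eval_fps (gf s B) \<rho>) * (gf s B oo (fps_const \<rho> * fps_X))"

lemma delta_pos: "delta s n > 0"
  by (cases s) auto

lemma gf_nonneg: "fps_nth (gf s B) n \<ge> 0"
  using delta_pos[of n] by (simp add: gf_def)

lemma finite_slice: "finite (slice B n)"
  using comb_class by (simp add: comb_class_def)

lemma gf_eq_0_iff: "fps_nth (gf s B) n = 0 \<longleftrightarrow> slice B n = {}"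
  using delta_pos[of n] finite_slice[of n] by (simp add: gf_def)

text \<open>
  Aperiodicity in the form that excludes roots of unity as solutions of \<open>size_gf(z) = 1\<close>. It also
  entails that the support is not empty, so that \<open>B(\<rho>) > 0\<close>.
\<close>

lemma exists_nonmultiple:
  assumes "d \<ge> 2"
  shows "\<exists>n. fps_nth (gf s B) n \<noteq> 0 \<and> \<not> d dvd n"
proof (rule ccontr)
  assume "\<not> ?thesis"
  then have "support (gf s B) \<subseteq> {0 + d * j | j. True}"
    by (auto simp: support_def dvd_def)
  then show False
    using aperiodic assms unfolding periodic_series_def by blast
qed

lemma gf_rho_pos: "eval_fps (gf s B) \<rho> > 0"
proof -
  obtain n where "fps_nth (gf s B) n \<noteq> 0" using exists_nonmultiple[of 2] by auto
  then have "fps_nth (gf s B) n > 0" using gf_nonneg[of n] by simp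
  then show ?thesis
    unfolding eval_fps_def using rho gf_nonneg
    by (intro suminf_pos2[where i = n] summable_fps) auto
qed

lemma size_gf_nth: "fps_nth size_gf n = fps_nth (gf s B) n * \<rho> ^ n / eval_fps (gf s B) \<rho>"
  by (simp add: size_gf_def fps_compose_linear)

lemma size_gf_nonneg: "fps_nth size_gf n \<ge> 0"
  using gf_nonneg[of n] rho gf_rho_pos by (simp add: size_gf_nth)

lemma size_gf_eq_0_iff: "fps_nth size_gf n = 0 \<longleftrightarrow> slice B n = {}"
  using rho gf_rho_pos by (simp add: size_gf_nth gf_eq_0_iff)

lemma size_gf_sums: "fps_nth size_gf sums 1"
  using sums_divide[OF sums_eval_fps[of \<rho> "gf s B"], of "eval_fps (gf s B) \<rho>"] rho gf_rho_pos
  by (simp add: size_gf_nth[abs_def])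

lemma eval_size_gf: "eval_fps size_gf 1 = 1"
  using sums_unique[OF size_gf_sums] by (simp add: eval_fps_def)

lemma radius_size_gf: "fps_conv_radius size_gf > 1"
proof -
  obtain R where R: "\<rho> < R" "ereal R < fps_conv_radius (gf s B)"
    using ereal_dense2[OF rho(2)] by auto
  have "summable (\<lambda>n. fps_nth (gf s B) n * R ^ n / eval_fps (gf s B) \<rho>)"
    using R rho by (intro summable_divide summable_fps) auto
  then have "summable (\<lambda>n. fps_nth size_gf n * (R / \<rho>) ^ n)"
    using rho by (simp add: size_gf_nth power_divide)
  from conv_radius_geI[OF this] have "ereal (R / \<rho>) \<le> fps_conv_radius size_gf"
    using R rho by (simp add: fps_conv_radius_def)
  moreover have "1 < ereal (R / \<rho>)"
    using R rho by (simp add: one_ereal_def)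
  ultimately show ?thesis by (rule less_le_trans[rotated])
qed

lemma eval_deriv_size_gf:
  "eval_fps (fps_deriv size_gf) 1 = \<rho> * eval_fps (fps_deriv (gf s B)) \<rho> / eval_fps (gf s B) \<rho>"
proof -
  have "ereal \<rho> < fps_conv_radius (fps_deriv (gf s B))"
    using rho(2) fps_conv_radius_deriv by (rule less_le_trans)
  then have "(\<lambda>n. fps_nth (fps_deriv (gf s B)) n * \<rho> ^ n) sums eval_fps (fps_deriv (gf s B)) \<rho>"
    using rho by (intro sums_eval_fps) simp
  from sums_divide[OF sums_mult[OF this, of \<rho>], of "eval_fps (gf s B) \<rho>"]
  have "(\<lambda>n. fps_nth (fps_deriv size_gf) n)
          sums (\<rho> * eval_fps (fps_deriv (gf s B)) \<rho> / eval_fps (gf s B) \<rho>)"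
    by (simp add: size_gf_nth mult_ac)
  from sums_unique[OF this] show ?thesis by (simp add: eval_fps_def)
qed

lemma set_sampler: "(\<beta>, t) \<in> set_spmf G \<Longrightarrow> \<beta> \<in> objs B"
proof -
  assume "(\<beta>, t) \<in> set_spmf G"
  then have "\<beta> \<in> set_spmf (map_spmf fst G)" by force
  then have "spmf (map_spmf fst G) \<beta> \<noteq> 0" by (metis in_set_spmf_iff_spmf)
  then show "\<beta> \<in> objs B" using sampler unfolding boltzmann_sampler_def by metis
qed

lemma spmf_size: "spmf (map_spmf (\<lambda>(\<beta>, t). csize B \<beta>) G) n = fps_nth size_gf n"
proof -
  have "spmf (map_spmf (\<lambda>(\<beta>, t). csize B \<beta>) G) n = spmf (map_spmf (csize B) (map_spmf fst G)) n"
    by (simp add: spmf.map_comp o_def case_prod_beta')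
  also have "\<dots> = measure (measure_spmf (map_spmf fst G)) (csize B -` {n})"
    by (simp only: spmf_map)
  also have "\<dots> = measure (measure_spmf (map_spmf fst G)) (slice B n)"
    by (rule measure_spmf.finite_measure_eq_AE)
       (auto simp: slice_def dest: set_sampler)
  also have "\<dots> = (\<Sum>\<beta>\<in>slice B n. spmf (map_spmf fst G) \<beta>)"
    using measure_spmf.finite_measure_eq_sum_singleton[OF finite_slice[of n], of "map_spmf fst G"]
    by (simp add: spmf_conv_measure_spmf del: spmf_map measure_map_spmf)
  also have "\<dots> = (\<Sum>\<beta>\<in>slice B n. delta s n * \<rho> ^ n / eval_fps (gf s B) \<rho>)"
    using sampler by (intro sum.cong) (auto simp: boltzmann_sampler_def slice_def)
  also have "\<dots> = fps_nth size_gf n"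
    by (simp add: size_gf_nth gf_def)
  finally show ?thesis .
qed

lemma lossless_sampler: "lossless_spmf G"
proof -
  let ?S = "map_spmf (\<lambda>(\<beta>, t). csize B \<beta>) G"
  have "ennreal (weight_spmf ?S) = (\<Sum>n. ennreal (fps_nth size_gf n))"
    unfolding weight_spmf_eq_nn_integral_spmf by (simp only: nn_integral_count_space_nat spmf_size)
  also have "\<dots> = 1"
    using suminf_ennreal_eq[OF size_gf_nonneg size_gf_sums] by simp
  finally have "weight_spmf ?S = 1" by simp
  then show ?thesis by (simp add: lossless_spmf_def)
qed

text \<open>
  The mean is \<open>size_gf'(1)\<close>, and \<open>1\<close> lies inside the disc of convergence.
\<close>

lemma mean_size_finite:
  "(\<integral>\<^sup>+ i. of_nat i \<partial>measure_spmf (map_spmf (\<lambda>(\<beta>, t). csize B \<beta>) G)) < \<top>"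
proof -
  have "summable (\<lambda>n. fps_nth (fps_deriv size_gf) n * 1 ^ n)"
    using less_le_trans[OF radius_size_gf fps_conv_radius_deriv]
    by (intro summable_fps) (simp add: one_ereal_def)
  then have "summable (\<lambda>n. real (Suc n) * fps_nth size_gf (Suc n))"
    by (simp del: of_nat_Suc)
  then have sm: "summable (\<lambda>n. real n * fps_nth size_gf n)"
    by (subst (asm) summable_Suc_iff)
  have "(\<integral>\<^sup>+ i. of_nat i \<partial>measure_spmf (map_spmf (\<lambda>(\<beta>, t). csize B \<beta>) G)) =
     (\<Sum>n. ennreal (fps_nth size_gf n) * of_nat n)"
    unfolding nn_integral_measure_spmf spmf_size by (rule nn_integral_count_space_nat)
  also have "\<dots> = (\<Sum>n. ennreal (real n * fps_nth size_gf n))"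
    by (intro suminf_cong)
       (simp add: ennreal_of_nat_eq_real_of_nat mult.commute size_gf_nonneg flip: ennreal_mult)
  also have "\<dots> = ennreal (\<Sum>n. real n * fps_nth size_gf n)"
    by (rule suminf_ennreal2) (auto simp: size_gf_nonneg sm)
  finally show ?thesis by simp
qed

sublocale positive_size_sampler B G
proof
  show "lossless_spmf G" by (rule lossless_sampler)
  show "csize B \<beta> > 0" if "(\<beta>, t) \<in> set_spmf G" for \<beta> t
    using set_sampler[OF that] slice_0 by (auto simp: slice_def intro: gr0I)
qed

lemma success_prob_eq: "success_prob B G n = fps_nth (1 / (1 - size_gf)) n"
proof -
  have "Abs_fps (spmf size_spmf) = size_gf"
    by (rule fps_ext) (simp only: spmf_size fps_nth_Abs_fps)
  then show ?thesis by (simp only: success_prob_renewal)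
qed

lemma mean_size_pos: "eval_fps (fps_deriv size_gf) 1 > 0"
  and success_prob_asymptotics:
    "\<exists>r. 0 < r \<and> r < 1 \<and>
       (\<lambda>n. success_prob B G n - 1 / eval_fps (fps_deriv size_gf) 1) \<in> O(\<lambda>n. r ^ n)"
proof -
  have size_0: "fps_nth size_gf 0 = 0" by (simp add: size_gf_eq_0_iff slice_0)
  have aper: "\<exists>n. fps_nth size_gf n \<noteq> 0 \<and> \<not> d dvd n" if "d \<ge> 2" for d
    using exists_nonmultiple[OF that] by (simp add: size_gf_eq_0_iff gf_eq_0_iff)
  note renewal = renewal_exponential[OF size_gf_nonneg radius_size_gf eval_size_gf size_0 aper]
  show "eval_fps (fps_deriv size_gf) 1 > 0"
    by (rule renewal(1))
  show "\<exists>r. 0 < r \<and> r < 1 \<and>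
       (\<lambda>n. success_prob B G n - 1 / eval_fps (fps_deriv size_gf) 1) \<in> O(\<lambda>n. r ^ n)"
    unfolding success_prob_eq by (rule renewal(2))
qed

text \<open>
  A composite object of size \<open>n\<close> exhibits a list of components that a trial draws with positive
  probability.
\<close>

lemma success_prob_pos_composition:
  assumes "\<gamma> \<in> slice (composition s A B) n"
  shows "success_prob B G n > 0"
proof -
  obtain \<beta>s where "set \<beta>s \<subseteq> objs B" "total_size B \<beta>s = n"
    using composition_components[OF assms] .
  moreover have "spmf size_spmf (csize B \<beta>) > 0" if "\<beta> \<in> objs B" for \<beta>
    using that size_gf_nonneg[of "csize B \<beta>"] size_gf_eq_0_iff[of "csize B \<beta>"]
    by (simp only: spmf_size) (auto simp: slice_def less_le)
  ultimately show ?thesis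
    using success_prob_pos[of \<beta>s] by auto
qed

end

section \<open>Running time of the leap generator\<close>

text \<open>
  A large constant covers the finitely many exceptions to an asymptotic bound, because \<open>n \<ge> 1\<close>. The
  cost of a core needs such a bound: the core-size can be small although \<open>n\<close> is large.
\<close>

lemma bigo_id_bound:
  fixes f :: "nat \<Rightarrow> real"
  assumes "f \<in> O(\<lambda>n. real n)"
  obtains c where "c \<ge> 0" "\<And>n. n > 0 \<Longrightarrow> \<bar>f n\<bar> \<le> c * real n"
proof -
  obtain C where C: "C > 0" "eventually (\<lambda>n. \<bar>f n\<bar> \<le> C * real n) sequentially"
    using landau_o.bigE[OF assms] by auto
  then obtain N where N: "\<And>n. n \<ge> N \<Longrightarrow> \<bar>f n\<bar> \<le> C * real n"
    by (auto simp: eventually_sequentially)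
  define D where "D = (\<Sum>n<N. \<bar>f n\<bar>)"
  have D: "D \<ge> 0" by (simp add: D_def sum_nonneg)
  show ?thesis
  proof (rule that)
    show "C + D \<ge> 0" using C D by simp
    fix n :: nat assume n: "n > 0"
    show "\<bar>f n\<bar> \<le> (C + D) * real n"
    proof (cases "n < N")
      case True
      then have "\<bar>f n\<bar> \<le> D"
        unfolding D_def by (intro member_le_sum[where f = "\<lambda>n. \<bar>f n\<bar>"]) auto
      also have "\<dots> \<le> D * real n" using n D by (simp add: mult_le_cancel_left1)
      also have "\<dots> \<le> (C + D) * real n" using C by (intro mult_right_mono) auto
      finally show ?thesis .
    next
      case False
      then have "\<bar>f n\<bar> \<le> C * real n" using N by simp
      also have "\<dots> \<le> (C + D) * real n" using D by (intro mult_right_mono) auto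
      finally show ?thesis .
    qed
  qed
qed

lemma lossless_assemble: "lossless_spmf (assemble s A B n \<alpha> \<beta>s)"
proof (cases s)
  case Labeled
  have "id \<in> {\<pi>. \<pi> permutes {1..n}}" by (simp add: permutes_id)
  then show ?thesis
    using Labeled finite_permutations[of "{1..n}"] by (auto simp del: permutes_id)
qed simp

context boltzmann
begin

lemma expected_time_leap_generator:
  assumes n: "success_prob B G n > 0"
    and lin: "\<And>\<beta> t. (\<beta>, t) \<in> set_spmf G \<Longrightarrow> t \<le> c * csize B \<beta>"
    and K: "1 + of_nat c * (\<integral>\<^sup>+ i. of_nat i \<partial>measure_spmf size_spmf) \<le> ennreal K" "K \<ge> 0"
    and GA: "\<And>k. k \<le> n \<Longrightarrow> k = 0 \<longleftrightarrow> n = 0 \<Longrightarrow> lossless_spmf (GA k) \<and> expected_time (GA k) \<le> ennreal b" "b \<ge> 0"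
  shows "expected_time (leap_generator s A B GA G a n) \<le>
           ennreal ((real n * K + (b + real (a n))) / success_prob B G n)"
proof (rule expected_time_restart[where R = "leap_trial B G n"
      and S = "\<lambda>\<beta>s. total_size B \<beta>s = n"
      and F = "\<lambda>\<beta>s. bind_spmf (GA (length \<beta>s)) (\<lambda>(\<alpha>, t').
                      map_spmf (\<lambda>\<gamma>. (\<gamma>, t' + a n)) (assemble s A B n \<alpha> \<beta>s))"])
  show "leap_generator s A B GA G a n =
    bind_spmf (leap_trial B G n) (\<lambda>(\<beta>s, t).
      if total_size B \<beta>s = n
      then map_spmf (\<lambda>(x, t'). (x, t + t'))
             (bind_spmf (GA (length \<beta>s)) (\<lambda>(\<alpha>, t').
                map_spmf (\<lambda>\<gamma>. (\<gamma>, t' + a n)) (assemble s A B n \<alpha> \<beta>s)))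
      else map_spmf (\<lambda>(x, t'). (x, t + t')) (leap_generator s A B GA G a n))"
    by (subst leap_generator.simps)
       (auto simp: map_spmf_bind_spmf spmf.map_comp o_def case_prod_beta' add.assoc intro!: bind_spmf_cong)
  show "lossless_spmf (leap_trial B G n)" by (rule lossless_leap_trial)
  show "success_prob B G n = measure (measure_spmf (leap_trial B G n)) {(\<beta>s, t). total_size B \<beta>s = n}"
    by (rule success_prob_def)
  show "expected_time (leap_trial B G n) \<le> ennreal (real n * K)"
  proof -
    have "expected_time (leap_trial B G n) \<le> of_nat n * ennreal K"
      by (rule order.trans[OF expected_time_leap_trial[OF lin] mult_left_mono[OF K(1)]]) auto
    then show ?thesis using K(2) by (simp add: ennreal_mult ennreal_of_nat_eq_real_of_nat)
  qed
  fix \<beta>s t assume b: "(\<beta>s, t) \<in> set_spmf (leap_trial B G n)" "total_size B \<beta>s = n"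
  let ?F = "bind_spmf (GA (length \<beta>s)) (\<lambda>(\<alpha>, t').
                      map_spmf (\<lambda>\<gamma>. (\<gamma>, t' + a n)) (assemble s A B n \<alpha> \<beta>s))"
  have "length \<beta>s \<le> n" "length \<beta>s = 0 \<longleftrightarrow> n = 0"
    using set_leap_trial[OF b(1)] b(2) by auto
  from GA(1)[OF this] have k: "lossless_spmf (GA (length \<beta>s))" "expected_time (GA (length \<beta>s)) \<le> ennreal b"
    by auto
  show F: "lossless_spmf ?F"
    using k(1) lossless_assemble by (auto simp: case_prod_beta')
  note em = emeasure_lossless_spmf
  have "expected_time ?F = (\<integral>\<^sup>+ z. of_nat (snd z) + of_nat (a n) \<partial>measure_spmf (GA (length \<beta>s)))"
    unfolding expected_time_lossless[OF F]
    by (simp add: nn_integral_bind_spmf case_prod_beta' o_def em[OF lossless_assemble] space_measure_spmf)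
  also have "\<dots> = expected_time (GA (length \<beta>s)) + of_nat (a n)"
    by (simp add: expected_time_lossless[OF k(1)] nn_integral_add em[OF k(1)] space_measure_spmf case_prod_beta')
  also have "\<dots> \<le> ennreal b + ennreal (real (a n))"
    using k(2) by (intro add_mono) (auto simp: ennreal_of_nat_eq_real_of_nat)
  finally show "expected_time ?F \<le> ennreal (b + real (a n))"
    using GA(2) by simp
qed (use n K GA(2) in auto)

text \<open>
  Every trial takes expected time \<open>O(n)\<close>, the expected number of trials \<open>1 / q\<^sub>n\<close> tends to \<open>\<mu>\<close>, and the
  work after the successful trial is \<open>O(n)\<close>.
\<close>

theorem linear_expected_time_leap_generator:
  assumes GA: "exact_size_sampler A GA" "comb_class s A" "\<And>k. k \<ge> 1 \<Longrightarrow> slice A k \<noteq> {}"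
    and a: "(\<lambda>n. real (a n)) \<in> O(\<lambda>n. real n)"
    and TA: "linear_expected_time {k. slice A k \<noteq> {}} GA"
    and TB: "linear_time B G"
  shows "linear_expected_time {n. slice (composition s A B) n \<noteq> {}} (leap_generator s A B GA G a)"
proof -
  obtain c where lin: "\<And>\<beta> t. (\<beta>, t) \<in> set_spmf G \<Longrightarrow> t \<le> c * csize B \<beta>"
    using TB by (fastforce simp: linear_time_def)
  have "1 + of_nat c * (\<integral>\<^sup>+ i. of_nat i \<partial>measure_spmf size_spmf) < \<top>"
    using mean_size_finite by (simp add: ennreal_mult_less_top of_nat_less_top)
  then obtain K where K: "1 + of_nat c * (\<integral>\<^sup>+ i. of_nat i \<partial>measure_spmf size_spmf) = ennreal K" "K \<ge> 0"
    by (metis ennreal_cases less_irrefl)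
  obtain T where T: "T \<in> O(\<lambda>n. real n)" "\<And>k. slice A k \<noteq> {} \<Longrightarrow> expected_time (GA k) \<le> ennreal (T k)"
    using TA by (auto simp: linear_expected_time_def)
  obtain cA where cA: "cA \<ge> 0" "\<And>n. n > 0 \<Longrightarrow> \<bar>T n\<bar> \<le> cA * real n"
    using bigo_id_bound[OF T(1)] by blast
  have lossless_GA: "lossless_spmf (GA k)" if "slice A k \<noteq> {}" for k
  proof -
    have "map_spmf fst (GA k) = spmf_of_set (slice A k)" "finite (slice A k)"
      using GA(1,2) that unfolding exact_size_sampler_def comb_class_def by blast+
    then have "lossless_spmf (map_spmf fst (GA k))"
      using that by (simp only: lossless_spmf_of_set simp_thms)
    then show ?thesis by simp
  qed
  \<comment> \<open>The linear bound is \<open>0\<close> at \<open>n = 0\<close>, but drawing a core of size \<open>0\<close> may take time.\<close>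
  define b where "b = (\<lambda>n. if n = 0 then \<bar>T 0\<bar> else cA * real n)"
  define T' where "T' = (\<lambda>n. (real n * K + (b n + real (a n))) / success_prob B G n)"
  have "expected_time (leap_generator s A B GA G a n) \<le> ennreal (T' n)"
    if n: "slice (composition s A B) n \<noteq> {}" for n
    unfolding T'_def
  proof (rule expected_time_leap_generator[OF _ lin])
    show "success_prob B G n > 0"
      using n success_prob_pos_composition by blast
    show "1 + of_nat c * (\<integral>\<^sup>+ i. of_nat i \<partial>measure_spmf size_spmf) \<le> ennreal K"
      using K by simp
    show "b n \<ge> 0" using cA by (simp add: b_def)
    fix k assume k: "k \<le> n" "k = 0 \<longleftrightarrow> n = 0"
    \<comment> \<open>The core-size \<open>0\<close> occurs only for \<open>n = 0\<close>, where the given composite object provides the core.\<close>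
    have Ak: "slice A k \<noteq> {}"
    proof (cases "k = 0")
      case False
      then show ?thesis using GA(3)[of k] by simp
    next
      case True
      then have "n = 0" using k by simp
      then obtain \<gamma> where "\<gamma> \<in> slice (composition s A B) 0" using n by blast
      from composition_components[OF this] obtain \<alpha> \<beta>s
        where \<alpha>: "\<alpha> \<in> slice A (length \<beta>s)" and "set \<beta>s \<subseteq> objs B" "total_size B \<beta>s = 0" .
      then have "set \<beta>s \<subseteq> slice B 0" by (auto simp: total_size_def slice_def)
      then have "\<beta>s = []" using slice_0 by simp
      then have "\<alpha> \<in> slice A 0" using \<alpha> by simp
      then show ?thesis using True by auto
    qed
    have "T k \<le> b n"
    proof (cases "k = 0")
      case True
      then show ?thesis using k by (simp add: b_def)
    next
      case False
      then have "T k \<le> cA * real k" using cA(2)[of k] by simp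
      also have "\<dots> \<le> cA * real n" using k cA(1) by (intro mult_left_mono) auto
      finally show ?thesis using False k by (simp add: b_def)
    qed
    then show "lossless_spmf (GA k) \<and> expected_time (GA k) \<le> ennreal (b n)"
      using lossless_GA[OF Ak] T(2)[OF Ak] by (auto intro: order.trans ennreal_leI)
  qed (use K in auto)
  moreover have "T' \<in> O(\<lambda>n. real n)"
  proof -
    define \<mu> where "\<mu> = eval_fps (fps_deriv size_gf) 1"
    have \<mu>: "\<mu> > 0" by (simp add: \<mu>_def mean_size_pos)
    obtain r where r: "0 < r" "r < 1" "(\<lambda>n. success_prob B G n - 1 / \<mu>) \<in> O(\<lambda>n. r ^ n)"
      using success_prob_asymptotics by (auto simp: \<mu>_def)
    obtain C where C: "eventually (\<lambda>n. norm (success_prob B G n - 1 / \<mu>) \<le> C * r ^ n) sequentially"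
      using landau_o.bigE[OF r(3)] r(1) by auto
    have "(\<lambda>n. C * r ^ n) \<longlonglongrightarrow> 0"
      using r by (intro tendsto_mult_right_zero LIMSEQ_power_zero) auto
    then have "(\<lambda>n. success_prob B G n - 1 / \<mu>) \<longlonglongrightarrow> 0"
      by (rule Lim_null_comparison[OF C])
    then have "(\<lambda>n. success_prob B G n) \<longlonglongrightarrow> 1 / \<mu>"
      by (rule LIM_zero_cancel)
    then have "eventually (\<lambda>n. 1 / (2 * \<mu>) < success_prob B G n) sequentially"
      by (rule order_tendstoD) (use \<mu> in \<open>simp add: field_simps\<close>)
    then have "eventually (\<lambda>n. norm (1 / success_prob B G n) \<le> 2 * \<mu> * norm (1 :: real)) sequentially"
    proof eventually_elim
      case (elim n)
      have "0 < 1 / (2 * \<mu>)" using \<mu> by simp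
      with elim have "success_prob B G n > 0" by linarith
      then show ?case using elim \<mu> by (simp add: field_simps)
    qed
    then have "(\<lambda>n. 1 / success_prob B G n) \<in> O(\<lambda>_. 1 :: real)"
      by (rule bigoI)
    moreover have "b \<in> O(\<lambda>n. real n)"
    proof (rule bigoI)
      show "eventually (\<lambda>n. norm (b n) \<le> cA * norm (real n)) sequentially"
        using eventually_gt_at_top[of 0] by eventually_elim (use cA(1) in \<open>simp add: b_def\<close>)
    qed
    then have "(\<lambda>n. real n * K + (b n + real (a n))) \<in> O(\<lambda>n. real n)"
      using a by (intro sum_in_bigo) (auto intro: bigoI[of _ K] simp: K(2))
    ultimately have "(\<lambda>n. (real n * K + (b n + real (a n))) * (1 / success_prob B G n)) \<in> O(\<lambda>n. real n * 1)"
      by (intro landau_o.big.mult)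
    then show ?thesis by (simp add: T'_def)
  qed
  ultimately show ?thesis
    unfolding linear_expected_time_def by blast
qed

end

theorem proposition1:
  fixes s :: setting
    and A :: "'a comb_struct" and B :: "'b comb_struct"
    and GA :: "nat \<Rightarrow> 'a procedure" and GB :: "real \<Rightarrow> 'b procedure"
    and assembly_cost :: "nat \<Rightarrow> nat"
    and \<rho> \<mu> :: real
  assumes "admissible_scheme s A B"
    and "ereal \<rho> = fps_conv_radius (gf s (composition s A B))"
    and "\<mu> = \<rho> * eval_fps (fps_deriv (gf s B)) \<rho> / eval_fps (gf s B) \<rho>"
    and "boltzmann_sampler s B \<rho> (GB \<rho>)"
    and "exact_size_sampler A GA"
    and "(\<lambda>n. real (assembly_cost n)) \<in> O(\<lambda>n. real n)"
  shows "(\<forall>n. success_prob B (GB \<rho>) n =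
            fps_nth (1 / (1 - fps_const (1 / eval_fps (gf s B) \<rho>) *
                              (gf s B oo (fps_const \<rho> * fps_X)))) n) \<and>
         (\<exists>r. 0 < r \<and> r < 1 \<and>
            (\<lambda>n. success_prob B (GB \<rho>) n - 1 / \<mu>) \<in> O(\<lambda>n. r ^ n)) \<and>
         (linear_expected_time {k. slice A k \<noteq> {}} GA \<and> linear_time B (GB \<rho>) \<longrightarrow>
          linear_expected_time {n. slice (composition s A B) n \<noteq> {}}
            (leap_generator s A B GA (GB \<rho>) assembly_cost))"
proof -
  have scheme: "composition_scheme s A B" and super: "supercritical s A B"
    and aperiodic: "\<not> periodic_series (gf s B)" and core: "{k. k \<ge> 1} \<subseteq> support (gf s A)"
    using assms(1) by (auto simp: admissible_scheme_def)
  interpret boltzmann s B \<rho> "GB \<rho>"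
  proof
    show "comb_class s B" "slice B 0 = {}" using scheme by (auto simp: composition_scheme_def)
    have "0 < fps_conv_radius (gf s (composition s A B))"
      using scheme by (simp add: composition_scheme_def)
    then show "\<rho> > 0" by (simp flip: assms(2) add: zero_ereal_def)
    show "ereal \<rho> < fps_conv_radius (gf s B)"
      using super by (simp add: supercritical_def assms(2))
  qed (fact aperiodic assms(4))+
  have \<mu>: "\<mu> = eval_fps (fps_deriv size_gf) 1"
    by (simp add: eval_deriv_size_gf assms(3))
  have "slice A k \<noteq> {}" if "k \<ge> 1" for k
    using core that by (auto simp: support_def gf_def)
  then have "linear_expected_time {n. slice (composition s A B) n \<noteq> {}}
            (leap_generator s A B GA (GB \<rho>) assembly_cost)"
    if "linear_expected_time {k. slice A k \<noteq> {}} GA" "linear_time B (GB \<rho>)"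
    using linear_expected_time_leap_generator[OF assms(5) _ _ assms(6) that] scheme
    by (simp add: composition_scheme_def)
  then show ?thesis
    using success_prob_eq success_prob_asymptotics by (simp add: size_gf_def[symmetric] \<mu>)
qed

end
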